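(* Let $E,A\in\mathbb{R}^{n\times n}$ with $(E,A)$ regular, $B\in\mathbb{R}^{n\times m}$, $C\in\mathbb{R}^{m\times n}$, $D\in\mathbb{R}^{m\times m}$, and suppose the descriptor system $E\dot x=Ax+Bu$, $y=Cx+Du$ is completely controllable, completely observable, and positive real. Let $W\in\mathbb{R}^{n\times m}$ be such that $$E^TW=0,\qquad D+D^T-B^TW-W^TB\ge 0,$$ and $(E,A,C-W^TA)$ is completely observable. Then $$(E,\ A,\ B,\ C-W^TA,\ D-W^TB)$$ is a port-Hamiltonian realization of the system $(E,A,B,C,D)$; that is, the system with this quintuple of coefficients is port-Hamiltonian and $$C(sE-A)^{-1}B+D=(C-W^TA)(sE-A)^{-1}B+(D-W^TB).$$
   Context: For a real matrix $M$, $M\ge 0$ (resp. $M\le 0$) means $M$ is symmetric and positive (resp. negative) semidefinite; for complex matrices, Hermitian in place of symmetric. A descriptor system is identified with its quintuple $(E,A,B,C,D)$. Regular: $\det(\alpha E-\beta A)\ne 0$ for some $(\alpha,\beta)\in\mathbb{C}^2$. Completely controllable: $\operatorname{rank}[\alpha E-\beta A,\ B]=n$ for all $(\alpha,\beta)\in\mathbb{C}^2\setminus\{(0,0)\}$. The triplet $(E,A,C)$ (or the system) is completely observable: $\operatorname{rank}\begin{bmatrix}\alpha E-\beta A\\ C\end{bmatrix}=n$ for all $(\alpha,\beta)\in\mathbb{C}^2\setminus\{(0,0)\}$. Positive real: the transfer function $\mathcal{T}(s)=C(sE-A)^{-1}B+D$ is analytic in $\mathbb{C}_+=\{s\in\mathbb{C}:\operatorname{Re}(s)>0\}$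 and $\mathcal{T}(s)+\mathcal{T}(s)^H\ge 0$ for all $s\in\mathbb{C}_+$. Port-Hamiltonian (pH): $(E,A,B,C,D)$ is pH if there exist $J,R,Q\in\mathbb{R}^{n\times n}$ and $G,P\in\mathbb{R}^{n\times m}$ such that, with $S=\frac12(D+D^T)$ and $N=\frac12(D-D^T)$, $$\begin{bmatrix}A&B\\C&D\end{bmatrix}=\begin{bmatrix}(J-R)Q&G-P\\(G+P)^TQ&S+N\end{bmatrix},\qquad \begin{bmatrix}J&G\\-G^T&N\end{bmatrix}=-\begin{bmatrix}J&G\\-G^T&N\end{bmatrix}^T,$$ $$Q^TE=E^TQ\ge 0,\qquad \begin{bmatrix}Q^TRQ&Q^TP\\P^TQ&S\end{bmatrix}=\begin{bmatrix}Q^TRQ&Q^TP\\P^TQ&S\end{bmatrix}^T\ge 0.$$ *)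

theory Defs
  imports "HOL-Analysis.Analysis"
begin

text \<open>
  A matrix with rows indexed by \<open>'p\<close> and columns indexed by \<open>'n\<close> has type \<open>'a ^ 'n ^ 'p\<close>.
  In block matrices the row and column indices are combined by disjoint sums of index types.
\<close>

definition hblock :: "'a ^ 'n ^ 'p \<Rightarrow> 'a ^ 'm ^ 'p \<Rightarrow> 'a ^ ('n + 'm) ^ 'p" where
  "hblock M N = (\<chi> i j. case j of Inl k \<Rightarrow> M $ i $ k | Inr k \<Rightarrow> N $ i $ k)"

definition vblock :: "'a ^ 'n ^ 'p \<Rightarrow> 'a ^ 'n ^ 'q \<Rightarrow> 'a ^ 'n ^ ('p + 'q)" where
  "vblock M N = (\<chi> i. case i of Inl k \<Rightarrow> M $ k | Inr k \<Rightarrow> N $ k)"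

definition block :: "'a ^ 'n ^ 'p \<Rightarrow> 'a ^ 'm ^ 'p \<Rightarrow> 'a ^ 'n ^ 'q \<Rightarrow> 'a ^ 'm ^ 'q
    \<Rightarrow> 'a ^ ('n + 'm) ^ ('p + 'q)" where
  "block M11 M12 M21 M22 = vblock (hblock M11 M12) (hblock M21 M22)"

definition psd :: "real ^ 'n ^ 'n \<Rightarrow> bool" where
  "psd M \<longleftrightarrow> transpose M = M \<and> (\<forall>x. 0 \<le> x \<bullet> (M *v x))"

definition hermitian_transpose :: "complex ^ 'n ^ 'p \<Rightarrow> complex ^ 'p ^ 'n" where
  "hermitian_transpose M = map_matrix cnj (transpose M)"

text \<open>The quadratic form of a Hermitian matrix is real-valued, so only its real part is compared
  with zero.\<close>

definition hermitian_psd :: "complex ^ 'n ^ 'n \<Rightarrow> bool" where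
  "hermitian_psd M \<longleftrightarrow> hermitian_transpose M = M \<and>
     (\<forall>x. 0 \<le> Re (\<Sum>i\<in>UNIV. cnj (x $ i) * (M *v x) $ i))"

abbreviation cmat :: "real ^ 'n ^ 'p \<Rightarrow> complex ^ 'n ^ 'p" where
  "cmat \<equiv> map_matrix complex_of_real"

text \<open>The matrix \<open>\<alpha> E - \<beta> A\<close>.\<close>

definition pencil :: "complex \<Rightarrow> complex \<Rightarrow> real ^ 'n ^ 'n \<Rightarrow> real ^ 'n ^ 'n \<Rightarrow> complex ^ 'n ^ 'n" where
  "pencil \<alpha> \<beta> E A = (\<chi> i j. \<alpha> * cmat E $ i $ j - \<beta> * cmat A $ i $ j)"

definition regular_pencil :: "real ^ 'n ^ 'n \<Rightarrow> real ^ 'n ^ 'n \<Rightarrow> bool" where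
  "regular_pencil E A \<longleftrightarrow> (\<exists>\<alpha> \<beta>. det (pencil \<alpha> \<beta> E A) \<noteq> 0)"

definition completely_controllable ::
    "real ^ 'n ^ 'n \<Rightarrow> real ^ 'n ^ 'n \<Rightarrow> real ^ 'm ^ 'n \<Rightarrow> bool" where
  "completely_controllable E A B \<longleftrightarrow>
     (\<forall>\<alpha> \<beta>. (\<alpha>, \<beta>) \<noteq> (0, 0) \<longrightarrow> rank (hblock (pencil \<alpha> \<beta> E A) (cmat B)) = CARD('n))"

definition completely_observable ::
    "real ^ 'n ^ 'n \<Rightarrow> real ^ 'n ^ 'n \<Rightarrow> real ^ 'n ^ 'm \<Rightarrow> bool" where
  "completely_observable E A C \<longleftrightarrow>
     (\<forall>\<alpha> \<beta>. (\<alpha>, \<beta>) \<noteq> (0, 0) \<longrightarrow> rank (vblock (pencil \<alpha> \<beta> E A) (cmat C)) = CARD('n))"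

text \<open>The value at \<open>s\<close> of \<open>C (s E - A)\<^sup>-\<^sup>1 B + D\<close>; it is meaningful only where
  \<open>det (s E - A) \<noteq> 0\<close>, since \<open>matrix_inv\<close> is unspecified on singular matrices.\<close>

definition transfer_function :: "real ^ 'n ^ 'n \<Rightarrow> real ^ 'n ^ 'n \<Rightarrow> real ^ 'm ^ 'n
    \<Rightarrow> real ^ 'n ^ 'm \<Rightarrow> real ^ 'm ^ 'm \<Rightarrow> complex \<Rightarrow> complex ^ 'm ^ 'm" where
  "transfer_function E A B C D s = cmat C ** matrix_inv (pencil s 1 E A) ** cmat B + cmat D"

text \<open>The transfer function is a rational function, so being analytic in the open right half-plane
  allows removable singularities at zeros of \<open>det (s E - A)\<close>: the function \<open>T\<close> below is
  its analytic continuation. For a regular pencil these zeros are finite in number, which makes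
  \<open>T\<close> unique on the half-plane.\<close>

definition positive_real :: "real ^ 'n ^ 'n \<Rightarrow> real ^ 'n ^ 'n \<Rightarrow> real ^ 'm ^ 'n
    \<Rightarrow> real ^ 'n ^ 'm \<Rightarrow> real ^ 'm ^ 'm \<Rightarrow> bool" where
  "positive_real E A B C D \<longleftrightarrow>
     (\<exists>T :: complex \<Rightarrow> complex ^ 'm ^ 'm.
        (\<forall>s. Re s > 0 \<and> det (pencil s 1 E A) \<noteq> 0 \<longrightarrow> T s = transfer_function E A B C D s) \<and>
        (\<forall>i j. (\<lambda>s. T s $ i $ j) analytic_on {s. Re s > 0}) \<and>
        (\<forall>s. Re s > 0 \<longrightarrow> hermitian_psd (T s + hermitian_transpose (T s))))"

definition port_hamiltonian :: "real ^ 'n ^ 'n \<Rightarrow> real ^ 'n ^ 'n \<Rightarrow> real ^ 'm ^ 'n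
    \<Rightarrow> real ^ 'n ^ 'm \<Rightarrow> real ^ 'm ^ 'm \<Rightarrow> bool" where
  "port_hamiltonian E A B C D \<longleftrightarrow>
     (\<exists>(J :: real ^ 'n ^ 'n) (R :: real ^ 'n ^ 'n) (Q :: real ^ 'n ^ 'n)
       (G :: real ^ 'm ^ 'n) (P :: real ^ 'm ^ 'n).
        let S = (1 / 2) *\<^sub>R (D + transpose D);
            N = (1 / 2) *\<^sub>R (D - transpose D);
            \<Gamma> = block J G (- transpose G) N
        in block A B C D = block ((J - R) ** Q) (G - P) (transpose (G + P) ** Q) (S + N) \<and>
           \<Gamma> = - transpose \<Gamma> \<and>
           transpose Q ** E = transpose E ** Q \<and>
           psd (transpose E ** Q) \<and>
           psd (block (transpose Q ** R ** Q) (transpose Q ** P) (transpose P ** Q) S))"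

end

theory Submission
  imports Defs "HOL-Complex_Analysis.Complex_Analysis"
    "HOL-Computational_Algebra.Fundamental_Theorem_Algebra"
begin

no_notation fps_nth (infixl "$" 75)

text \<open>
  A Cayley transform turns the descriptor system into an ordinary discrete-time system whose
  transfer function has nonnegative real part on the unit disc. Its impulse response consists of the
  Taylor coefficients of that function, so integrating over circles shows that the discrete system
  is passive. By controllability the required supply is a finite quadratic form, which yields
  \<open>P \<ge> 0\<close> with \<open>\<xi> \<bullet> P \<eta> \<le> u \<bullet> (C \<xi> + D u)\<close> whenever
  \<open>E \<eta> = A \<xi> + B u\<close>; this includes the modes at infinity. The inequality is unchanged
  when \<open>C\<close>, \<open>D\<close> are shifted by \<open>W\<^sup>T A\<close>, \<open>W\<^sup>T B\<close>, because
  \<open>W\<^sup>T E = 0\<close>. Since the shifted \<open>D + D\<^sup>T\<close> is positive semidefinite,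
  \<open>P = E\<^sup>T Q\<close> for some \<open>Q\<close> whose dissipation inequality holds for all
  \<open>(\<xi>, u)\<close>. Observability makes \<open>Q\<close> invertible, and then
  \<open>J - R = A Q\<^sup>-\<^sup>1\<close>, \<open>G - P = B\<close>, \<open>G + P = Q\<^sup>-\<^sup>T C\<^sup>T\<close>.
\<close>

section \<open>Complexification and rank conditions\<close>

text \<open>With singular \<open>E\<close> the system is no ODE and its transfer function may have a
  pole at infinity; in general positive realness then does not even control the sign of
  \<open>D + transpose D\<close>. The Cayley transform is anchored at a real \<open>s > 0\<close>
  with \<open>s E - A\<close> invertible, which regularity supplies: the discrete system keeps the
  state dimension and real coefficients, and infinity becomes the ordinary eigenvalue -1, so that
  controllability at infinity is part of reachability. The required supply suits the data because a
  transfer function speaks only of trajectories starting at rest: it is an infimum over exactly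
  those, and passivity from rest bounds it below. There remains a gap between \<open>P\<close> and
  \<open>Q\<close>: \<open>P = transpose E ** Q\<close> fixes each \<open>Q x\<close> only modulo
  the kernel of \<open>transpose E\<close>, and says nothing about pairs with
  \<open>A x + B u\<close> outside the range of \<open>E\<close>. A stationary input for each state
  settles this freedom. Complex vectors enter because a real matrix may lack real eigenvectors;
  \<open>re_vec\<close> and \<open>im_vec\<close> confine a complex eigenvector to a real invariant
  subspace.\<close>

definition re_vec :: "complex ^ 'n \<Rightarrow> real ^ 'n" where "re_vec v = (\<chi> i. Re (v $ i))"
definition im_vec :: "complex ^ 'n \<Rightarrow> real ^ 'n" where "im_vec v = (\<chi> i. Im (v $ i))"
definition cvec :: "real ^ 'n \<Rightarrow> complex ^ 'n" where "cvec x = (\<chi> i. complex_of_real (x $ i))"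

lemma cvec_0: "cvec 0 = 0"
  by (simp add: cvec_def vec_eq_iff)

lemma cmat_mult: "cmat (M ** N) = cmat M ** cmat N"
  by (simp add: matrix_matrix_mult_def vec_eq_iff)

lemma cmat_transpose: "cmat (transpose M) = transpose (cmat M)"
  by (simp add: transpose_def vec_eq_iff)

lemma cmat_mat_1: "cmat (mat 1) = mat 1"
  by (simp add: mat_def vec_eq_iff)

lemma re_vec_mult: "re_vec (cmat M *v v) = M *v re_vec v"
  by (simp add: re_vec_def matrix_vector_mult_def vec_eq_iff)

lemma im_vec_mult: "im_vec (cmat M *v v) = M *v im_vec v"
  by (simp add: im_vec_def matrix_vector_mult_def vec_eq_iff)

lemma cmat_mult_cvec: "cmat M *v cvec x = cvec (M *v x)"
  by (simp add: cvec_def matrix_vector_mult_def vec_eq_iff)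

lemma complex_vec_eq_0_iff: "v = 0 \<longleftrightarrow> re_vec v = 0 \<and> im_vec v = 0"
  by (auto simp: re_vec_def im_vec_def vec_eq_iff complex_eq_iff)

lemma cmat_mult_eq_0:
  assumes "M *v re_vec v = 0" "M *v im_vec v = 0"
  shows "cmat M *v v = 0"
  by (simp add: complex_vec_eq_0_iff re_vec_mult im_vec_mult assms)

lemma pencil_mult_vec:
  "pencil \<alpha> \<beta> E A *v v = \<alpha> *s (cmat E *v v) - \<beta> *s (cmat A *v v)"
  by (simp add: pencil_def matrix_vector_mult_def vec_eq_iff sum_subtractf sum_distrib_left
      algebra_simps)

lemma full_column_rank_kernel:
  fixes M :: "'a::field ^ 'n ^ 'm"
  assumes "rank M = CARD('n)" "M *v x = 0"
  shows "x = 0"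
proof -
  have "vec.dim (vec.span (rows M)) = vec.dimension (TYPE('a)) (TYPE('n))"
    using assms(1) by (simp add: row_rank_def_gen vec.dimension_def card_cart_basis)
  then have "vec.span (rows M) = UNIV"
    by (metis vec.dim_eq_full vec.dim_span)
  then show ?thesis
    using assms(2) matrix_left_invertible_span_rows_gen matrix_left_invertible_ker by blast
qed

text \<open>A nonzero entry \<open>w $ k\<close> lets the relation be solved for row
  \<open>k\<close>, so the remaining rows, one too few for full rank, already span.\<close>

lemma full_row_rank_kernel:
  fixes M :: "'a::field ^ 'n ^ 'm"
  assumes "rank M = CARD('m)" "transpose M *v w = 0"
  shows "w = 0"
proof (rule ccontr)
  assume "w \<noteq> 0"
  then obtain k where k: "w $ k \<noteq> 0" by (auto simp: vec_eq_iff)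
  have "(\<Sum>i\<in>UNIV. w $ i *s row i M) = 0"
    using assms(2) by (simp add: vec_eq_iff matrix_vector_mult_def transpose_def row_def
        mult.commute)
  moreover have "(\<Sum>i\<in>UNIV. w $ i *s row i M) = w $ k *s row k M + (\<Sum>i\<in>UNIV - {k}. w $ i *s row i M)"
    by (rule sum.remove) auto
  ultimately have "w $ k *s row k M = - (\<Sum>i\<in>UNIV - {k}. w $ i *s row i M)"
    by (simp add: eq_neg_iff_add_eq_0)
  then have "(1 / w $ k) *s (w $ k *s row k M) \<in> vec.span ((\<lambda>i. row i M) ` (UNIV - {k}))"
    by (simp only:) (intro vec.span_scale vec.span_neg vec.span_sum, auto intro: vec.span_base)
  then have rk: "row k M \<in> vec.span ((\<lambda>i. row i M) ` (UNIV - {k}))"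
    using k by simp
  have "rows M \<subseteq> vec.span ((\<lambda>i. row i M) ` (UNIV - {k}))"
  proof
    fix r assume "r \<in> rows M"
    then obtain i where "r = row i M" by (auto simp: rows_def)
    then show "r \<in> vec.span ((\<lambda>i. row i M) ` (UNIV - {k}))"
      using rk by (cases "i = k") (auto intro: vec.span_base)
  qed
  then have "vec.dim (rows M) \<le> card ((\<lambda>i. row i M) ` (UNIV - {k}))"
    by (intro vec.dim_le_card) auto
  also have "\<dots> \<le> card (UNIV - {k})" by (rule card_image_le) simp
  also have "\<dots> < CARD('m)" by (simp add: card_Diff_singleton)
  finally show False using assms(1) by (simp add: row_rank_def_gen)
qed

lemma vector_mult_hblock:
  "w v* hblock M N = 0 \<longleftrightarrow> w v* M = 0 \<and> w v* N = 0"
  for M :: "'a::field ^ 'n ^ 'p" and N :: "'a ^ 'm ^ 'p"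
  by (auto simp: hblock_def vector_matrix_mult_def vec_eq_iff split_sum_all)

lemma vblock_mult:
  "vblock M N *v v = 0 \<longleftrightarrow> M *v v = 0 \<and> N *v v = 0"
  for M :: "'a::field ^ 'n ^ 'p" and N :: "'a ^ 'n ^ 'q"
  by (auto simp: vblock_def matrix_vector_mult_def vec_eq_iff split_sum_all)

text \<open>Full row rank read as triviality of the left kernel, that is, the Hautus test;
  \<open>\<beta> = 0\<close> is the eigenvalue at infinity.\<close>

lemma completely_controllableD:
  assumes "completely_controllable E A B" "(\<alpha>, \<beta>) \<noteq> (0, 0)"
    and "\<alpha> *s (cmat (transpose E) *v w) = \<beta> *s (cmat (transpose A) *v w)"
    and "cmat (transpose B) *v w = 0"
  shows "w = 0"
proof (rule full_row_rank_kernel)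
  show "rank (hblock (pencil \<alpha> \<beta> E A) (cmat B)) = CARD('a)"
    using assms(1,2) unfolding completely_controllable_def by blast
  have "w v* pencil \<alpha> \<beta> E A = \<alpha> *s (w v* cmat E) - \<beta> *s (w v* cmat A)"
    by (simp add: pencil_def vector_matrix_mult_def vec_eq_iff sum_subtractf sum_distrib_left
      algebra_simps)
  then show "transpose (hblock (pencil \<alpha> \<beta> E A) (cmat B)) *v w = 0"
    using assms(3,4) by (simp add: vector_mult_hblock cmat_transpose)
qed

lemma completely_observableD:
  assumes "completely_observable E A C" "(\<alpha>, \<beta>) \<noteq> (0, 0)"
    and "\<alpha> *s (cmat E *v v) = \<beta> *s (cmat A *v v)"
    and "cmat C *v v = 0"
  shows "v = 0"
proof -
  have "rank (vblock (pencil \<alpha> \<beta> E A) (cmat C)) = CARD('a)"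
    using assms(1,2) unfolding completely_observable_def by blast
  moreover have "vblock (pencil \<alpha> \<beta> E A) (cmat C) *v v = 0"
    using assms(3,4) by (simp add: vblock_mult pencil_mult_vec)
  ultimately show ?thesis by (rule full_column_rank_kernel)
qed

section \<open>Eigenvectors in real invariant subspaces\<close>

text \<open>The set-based \<open>dependent\<close> does not see repetitions, so a coincidence
  \<open>f i = f j\<close> is turned into a relation separately.\<close>

lemma linear_relation:
  fixes f :: "nat \<Rightarrow> 'a::euclidean_space"
  shows "\<exists>c. (\<exists>i\<le>DIM('a). c i \<noteq> (0::real)) \<and> (\<Sum>i\<le>DIM('a). c i *\<^sub>R f i) = 0"
proof (cases "inj_on f {..DIM('a)}")
  case False
  then obtain i j where ij: "i \<le> DIM('a)" "j \<le> DIM('a)" "i \<noteq> j" "f i = f j"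
    by (auto simp: inj_on_def)
  define c where "c k = (if k = i then 1 else if k = j then -1 else (0::real))" for k
  have "(\<Sum>k\<le>DIM('a). c k *\<^sub>R f k) = (\<Sum>k\<in>{i, j}. c k *\<^sub>R f k)"
    by (rule sum.mono_neutral_right) (use ij in \<open>auto simp: c_def\<close>)
  also have "\<dots> = 0" using ij by (simp add: c_def)
  finally show ?thesis using ij by (intro exI[of _ c]) (auto simp: c_def)
next
  case True
  have "dependent (f ` {..DIM('a)})"
    using True by (intro dependent_biggerset) (auto simp: card_image)
  then obtain u v where u: "v \<in> f ` {..DIM('a)}" "u v \<noteq> 0" "(\<Sum>v\<in>f ` {..DIM('a)}. u v *\<^sub>R v) = 0"
    by (auto simp: dependent_finite)
  show ?thesis
  proof (intro exI[of _ "u \<circ> f"] conjI)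
    show "\<exists>i\<le>DIM('a). (u \<circ> f) i \<noteq> 0" using u by auto
    show "(\<Sum>i\<le>DIM('a). (u \<circ> f) i *\<^sub>R f i) = 0"
      using u(3) True by (simp add: sum.reindex)
  qed
qed

lemma re_vec_sum: "re_vec (\<Sum>i\<in>I. c i *s cvec (f i)) = (\<Sum>i\<in>I. Re (c i) *\<^sub>R f i)"
  by (simp add: re_vec_def cvec_def vec_eq_iff)

lemma im_vec_sum: "im_vec (\<Sum>i\<in>I. c i *s cvec (f i)) = (\<Sum>i\<in>I. Im (c i) *\<^sub>R f i)"
  by (simp add: im_vec_def cvec_def vec_eq_iff)

text \<open>The eigenvector is \<open>q(M) x\<close>, where \<open>(X - \<mu>) q\<close> is an annihilating polynomial of
  \<open>x\<close> of minimal degree.\<close>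

lemma real_invariant_subspace_eigenvector:
  fixes M :: "real ^ 'n ^ 'n"
  assumes S: "subspace S" and x: "x \<in> S" "x \<noteq> 0" and inv: "\<And>y. y \<in> S \<Longrightarrow> M *v y \<in> S"
  obtains v \<mu> where "v \<noteq> 0" "re_vec v \<in> S" "im_vec v \<in> S" "cmat M *v v = \<mu> *s v"
proof -
  define f where "f i = (((*v) M) ^^ i) x" for i
  have fS: "f i \<in> S" for i by (induction i) (auto simp: f_def x inv)
  have f0: "f 0 = x" and fSuc: "f (Suc i) = M *v f i" for i by (auto simp: f_def)
  define ev where "ev p = (\<Sum>i\<le>degree p. coeff p i *s cvec (f i))" for p :: "complex poly"
  define ann where "ann p \<longleftrightarrow> p \<noteq> 0 \<and> ev p = 0" for p
  obtain c where c: "\<exists>i\<le>DIM(real^'n). c i \<noteq> (0::real)" "(\<Sum>i\<le>DIM(real^'n). c i *\<^sub>R f i) = 0"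
    using linear_relation[of f] by blast
  \<comment> \<open>A real relation among the iterates of \<open>x\<close> is a polynomial
    annihilating \<open>x\<close>. Its degree may be below the summation range; the extra
    coefficients are zero.\<close>
  define p0 where "p0 = (\<Sum>i\<le>DIM(real^'n). monom (complex_of_real (c i)) i)"
  have cp0: "coeff p0 i = (if i \<le> DIM(real^'n) then of_real (c i) else 0)" for i
    unfolding p0_def by (simp add: coeff_sum sum.delta')
  have "ann p0"
  proof -
    have "p0 \<noteq> 0" using c(1) cp0 by (metis coeff_0 of_real_eq_0_iff)
    moreover have d0: "degree p0 \<le> DIM(real^'n)" by (rule degree_le) (simp add: cp0)
    have "ev p0 = (\<Sum>i\<le>DIM(real^'n). coeff p0 i *s cvec (f i))"
      unfolding ev_def
      by (rule sum.mono_neutral_left) (use d0 in \<open>auto simp: coeff_eq_0\<close>)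
    moreover have "\<dots> = (\<Sum>i\<le>DIM(real^'n). of_real (c i) *s cvec (f i))"
      by (rule sum.cong) (auto simp: cp0)
    moreover have "\<dots> = 0"
      unfolding complex_vec_eq_0_iff re_vec_sum im_vec_sum using c(2) by simp
    ultimately show ?thesis by (simp add: ann_def)
  qed
  then obtain p where p: "ann p" and min: "\<And>q. ann q \<Longrightarrow> degree p \<le> degree q"
    using ex_has_least_nat[of ann p0 degree] by blast
  \<comment> \<open>A nonzero constant cannot annihilate \<open>x\<close>; hence \<open>p\<close>
    has a root.\<close>
  have "degree p \<noteq> 0"
  proof
    assume d: "degree p = 0"
    have "coeff p 0 \<noteq> 0" using p d by (metis ann_def leading_coeff_0_iff)
    moreover have "coeff p 0 *s cvec x = 0" using p d by (simp add: ann_def ev_def f0)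
    ultimately show False using x(2) by (auto simp: cvec_def vec_eq_iff)
  qed
  then obtain \<mu> where "poly p \<mu> = 0"
    using alg_closed_imp_poly_has_root[of p] by auto
  then obtain q where q: "p = [:- \<mu>, 1:] * q" by (metis dvdE poly_eq_0_iff_dvd)
  have q0: "q \<noteq> 0" using p q by (auto simp: ann_def)
  have dp: "degree p = Suc (degree q)" unfolding q using degree_mult_eq[of "[:- \<mu>, 1:]" q] q0
    by (simp del: mult_pCons_left)
  have pq: "coeff p i = coeff (pCons 0 q) i - \<mu> * coeff q i" for i by (simp add: q)
  have "ev q \<noteq> 0" using min[of q] dp q0 by (auto simp: ann_def)
  \<comment> \<open>Multiplying a polynomial by \<open>X\<close> shifts its coefficients and acts on
    \<open>ev\<close> as \<open>M\<close>, so \<open>ev p = (M - \<mu>) (ev q)\<close>. Both sums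
    run to \<open>Suc (degree q)\<close>, where the one for \<open>\<mu> q\<close> gains only a zero
    term.\<close>
  moreover have "cmat M *v ev q = \<mu> *s ev q"
  proof -
    have "0 = ev p" using p by (simp add: ann_def)
    also have "\<dots> = (\<Sum>i\<le>Suc (degree q). coeff (pCons 0 q) i *s cvec (f i))
        - (\<Sum>i\<le>Suc (degree q). (\<mu> * coeff q i) *s cvec (f i))"
      unfolding ev_def dp pq by (simp only: vector_sub_rdistrib sum_subtractf)
    also have "(\<Sum>i\<le>Suc (degree q). coeff (pCons 0 q) i *s cvec (f i))
        = (\<Sum>i\<le>degree q. coeff q i *s (cmat M *v cvec (f i)))"
      by (simp add: sum.atMost_Suc_shift fSuc cmat_mult_cvec del: sum.atMost_Suc)
    also have "\<dots> = cmat M *v ev q"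
      by (simp add: ev_def vec.sum vector_scalar_commute)
    also have "(\<Sum>i\<le>Suc (degree q). (\<mu> * coeff q i) *s cvec (f i)) = \<mu> *s ev q"
      unfolding ev_def vec.scale_sum_right vector_smult_assoc by (simp add: coeff_eq_0)
    finally show ?thesis by simp
  qed
  moreover have "re_vec (ev q) \<in> S" "im_vec (ev q) \<in> S"
    unfolding ev_def re_vec_sum im_vec_sum by (intro subspace_sum subspace_scale S fS)+
  ultimately show ?thesis using that by blast
qed

section \<open>Extension of the dissipation inequality\<close>

text \<open>The component \<open>z\<close> of \<open>y\<close> orthogonal to \<open>S\<close>
  annihilates \<open>S\<close>, hence also \<open>y\<close>, hence itself.\<close>

lemma mem_subspace_if_annihilated:
  fixes S :: "'a::euclidean_space set"
  assumes S: "subspace S" and ann: "\<And>z. (\<And>s. s \<in> S \<Longrightarrow> z \<bullet> s = 0) \<Longrightarrow> z \<bullet> y = 0"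
  shows "y \<in> S"
proof -
  obtain p z where p: "p \<in> span S" and z: "\<And>w. w \<in> span S \<Longrightarrow> orthogonal z w" and y: "y = p + z"
    using orthogonal_subspace_decomp_exists[of S y] by metis
  have "z \<bullet> y = 0"
    using ann z by (simp add: orthogonal_def span_base)
  moreover have "z \<bullet> p = 0" using z p by (simp add: orthogonal_def)
  ultimately have "z = 0" by (simp add: y inner_add_right)
  moreover have "span S = S" using S span_eq_iff by blast
  then have "p \<in> S" using p by blast
  ultimately show ?thesis using y by simp
qed

text \<open>A quadratic function bounded below on \<open>S\<close> has no slope along its flat
  directions. Every \<open>z\<close> orthogonal to the sum of \<open>f(S)\<close> and the complement
  of \<open>S\<close> is such a direction, so \<open>b\<close> lies in that sum, which is
  solvability of the stationarity equation.\<close>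

lemma stationary_point_exists:
  fixes f :: "'a::euclidean_space \<Rightarrow> 'a"
  assumes S: "subspace S" and f: "linear f" and sym: "\<And>x y. x \<bullet> f y = f x \<bullet> y"
    and bound: "\<And>s. s \<in> S \<Longrightarrow> 0 \<le> s \<bullet> f s + b \<bullet> s + c"
  obtains s where "s \<in> S" "\<And>w. w \<in> S \<Longrightarrow> w \<bullet> (2 *\<^sub>R f s + b) = 0"
proof -
  define R where "R = {f s + w |s w. s \<in> S \<and> w \<in> S\<^sup>\<bottom>}"
  have perp: "subspace (S\<^sup>\<bottom>)" by (rule subspace_orthogonal_comp)
  have R_alt: "R = {x + y |x y. x \<in> f ` S \<and> y \<in> S\<^sup>\<bottom>}" by (auto simp: R_def)
  have "subspace R"
    unfolding R_alt by (intro subspace_sums perp linear_subspace_image f S)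
  moreover have "z \<bullet> b = 0" if z: "\<And>r. r \<in> R \<Longrightarrow> z \<bullet> r = 0" for z
  proof -
    have "z \<bullet> w = 0" if "w \<in> S\<^sup>\<bottom>" for w
    proof -
      have "f 0 + w \<in> R" unfolding R_def using that S subspace_0 by blast
      then show ?thesis using z[of "f 0 + w"] by (simp add: linear_0[OF f])
    qed
    then have "z \<in> S"
      by (intro mem_subspace_if_annihilated[OF S])
        (auto simp: orthogonal_comp_def orthogonal_def inner_commute)
    moreover have "z \<bullet> f z = 0"
    proof -
      have "f z + 0 \<in> R" unfolding R_def using \<open>z \<in> S\<close> perp subspace_0 by blast
      then show ?thesis using z[of "f z + 0"] by simp
    qed
    ultimately have *: "0 \<le> t * (b \<bullet> z) + c" for t
      using bound[of "t *\<^sub>R z"] by (simp add: subspace_scale[OF S] linear_scale[OF f])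
    have "b \<bullet> z = 0"
    proof (rule ccontr)
      assume "b \<bullet> z \<noteq> 0"
      \<comment> \<open>At this \<open>t\<close> the affine function equals -1.\<close>
      then show False using *[of "- (c + 1) / (b \<bullet> z)"] by simp
    qed
    then show ?thesis by (simp add: inner_commute)
  qed
  ultimately have "b \<in> R" by (rule mem_subspace_if_annihilated)
  then obtain s w where s: "s \<in> S" and w: "w \<in> S\<^sup>\<bottom>" and b: "b = f s + w" by (auto simp: R_def)
  show thesis
  proof
    show "(- 1/2) *\<^sub>R s \<in> S" using s S by (rule subspace_scale[rotated])
    show "v \<bullet> (2 *\<^sub>R f ((- 1/2) *\<^sub>R s) + b) = 0" if "v \<in> S" for v
      using w that by (simp add: linear_scale[OF f] linear_neg[OF f] b orthogonal_comp_def
          orthogonal_def)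
  qed
qed

lemma linear_selection:
  fixes R :: "('a::euclidean_space \<times> 'b::real_vector) set"
  assumes R: "subspace R" and ex: "\<And>x. \<exists>y. (x, y) \<in> R"
  obtains f where "linear f" "\<And>x. (x, f x) \<in> R"
proof -
  obtain g where g: "\<And>x. (x, g x) \<in> R" using ex by metis
  define f where "f x = (\<Sum>b\<in>Basis. (x \<bullet> b) *\<^sub>R g b)" for x
  have "linear f"
    by (rule linearI) (simp_all add: f_def inner_add_left scaleR_add_left sum.distrib
        scaleR_sum_right)
  moreover have "(x, f x) \<in> R" for x
  proof -
    have "(\<Sum>b\<in>Basis. (x \<bullet> b) *\<^sub>R (b, g b)) \<in> R"
      by (intro subspace_sum subspace_scale R g)
    also have "(\<Sum>b\<in>Basis. (x \<bullet> b) *\<^sub>R (b, g b)) = (x, f x)"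
      by (simp add: prod_eq_iff fst_sum snd_sum f_def euclidean_representation)
    finally show ?thesis .
  qed
  ultimately show ?thesis using that by blast
qed

lemma inner_transpose_mult: "x \<bullet> (transpose M *v y) = (M *v x) \<bullet> y"
  for M :: "real ^ 'n ^ 'm"
  by (metis dot_lmul_matrix inner_commute transpose_matrix_vector)

lemma inner_mult_transpose: "x \<bullet> (M *v y) = (transpose M *v x) \<bullet> y"
  for M :: "real ^ 'n ^ 'm"
  by (metis inner_transpose_mult transpose_transpose)

text \<open>The form \<open>u \<bullet> (C \<xi> + D u) - Q \<xi> \<bullet> (A \<xi> + B u)\<close> is prescribed on
  the pairs with \<open>A \<xi> + B u\<close> in the range of \<open>E\<close> and on those with \<open>\<xi> = 0\<close>.
  It is nonnegative on both subspaces, which together span everything. As in the completion of a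
  partial positive semidefinite block matrix, \<open>Q\<close> is chosen so that the cross terms between
  \<open>(\<xi>, K \<xi>)\<close> and \<open>(0, u)\<close> vanish.\<close>

lemma dissipation_extension:
  fixes E A P :: "real ^ 'n ^ 'n" and B :: "real ^ 'm ^ 'n"
    and C :: "real ^ 'n ^ 'm" and D :: "real ^ 'm ^ 'm"
  assumes P: "transpose P = P"
    and ctrl: "\<And>w. transpose E *v w = 0 \<Longrightarrow> transpose B *v w = 0 \<Longrightarrow> w = 0"
    and diss: "\<And>\<xi> \<eta> u. E *v \<eta> = A *v \<xi> + B *v u \<Longrightarrow> \<xi> \<bullet> (P *v \<eta>) \<le> u \<bullet> (C *v \<xi> + D *v u)"
    and D: "\<And>u. 0 \<le> u \<bullet> (D *v u)"
  obtains Q where "transpose E ** Q = P"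
    "\<And>\<xi> u. (Q *v \<xi>) \<bullet> (A *v \<xi> + B *v u) \<le> u \<bullet> (C *v \<xi> + D *v u)"
proof -
  \<comment> \<open>The directions in which \<open>(u, \<eta>)\<close> may move in
    \<open>E \<eta> = A \<xi> + B u\<close> while \<open>\<xi>\<close> stays fixed.\<close>
  define S where "S = {(u :: real ^ 'm, \<eta> :: real ^ 'n). E *v \<eta> = B *v u}"
  have S: "subspace S"
    by (auto simp: S_def subspace_def zero_prod_def matrix_vector_right_distrib
        matrix_vector_mult_scaleR)
  have Psym: "x \<bullet> (P *v y) = (P *v x) \<bullet> y" for x y
    by (metis inner_transpose_mult P)
  have surj: "\<exists>\<eta> u. y = E *v \<eta> + B *v u" for y
  proof -
    have "linear (\<lambda>(\<eta>, u). E *v \<eta> + B *v u)"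
      by (rule linearI) (auto simp: matrix_vector_right_distrib matrix_vector_mult_scaleR
          scaleR_add_right)
    then have "subspace (range (\<lambda>(\<eta>, u). E *v \<eta> + B *v u))"
      by (rule linear_subspace_image) simp
    moreover have "z \<bullet> y = 0" if z: "\<And>s. s \<in> range (\<lambda>(\<eta>, u). E *v \<eta> + B *v u) \<Longrightarrow> z \<bullet> s = 0" for z
    proof -
      have z': "z \<bullet> (E *v \<eta> + B *v u) = 0" for \<eta> u using z by auto
      have "transpose E *v z = 0"
        using z'[of "transpose E *v z" 0] by (simp add: inner_mult_transpose)
      moreover have "transpose B *v z = 0"
        using z'[of 0 "transpose B *v z"] by (simp add: inner_mult_transpose)
      ultimately have "z = 0" by (rule ctrl)
      then show ?thesis by simp
    qed
    ultimately have "y \<in> range (\<lambda>(\<eta>, u). E *v \<eta> + B *v u)"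
      by (rule mem_subspace_if_annihilated)
    then show ?thesis by auto
  qed
  \<comment> \<open>The derivative of
    \<open>u \<bullet> (C \<xi> + D u) - \<xi> \<bullet> P \<eta>\<close> along
    \<open>(u0, \<eta>0)\<close>. \<open>Rel\<close> collects the stationary points for all
    \<open>\<xi>\<close> at once; being a subspace, it allows a linear choice \<open>k\<close> of
    the input.\<close>
  define L where "L \<xi> u u0 \<eta>0 = u0 \<bullet> (C *v \<xi> + (D + transpose D) *v u) - \<eta>0 \<bullet> (P *v \<xi>)" for \<xi> u u0
      \<eta>0
  have L: "L 0 0 u0 \<eta>0 = 0" "L (\<xi> + \<xi>') (u + u') u0 \<eta>0 = L \<xi> u u0 \<eta>0 + L \<xi>' u' u0 \<eta>0"
    "L (c *\<^sub>R \<xi>) (c *\<^sub>R u) u0 \<eta>0 = c * L \<xi> u u0 \<eta>0" for \<xi> \<xi>' u u' u0 \<eta>0 c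
    by (simp_all add: L_def matrix_vector_right_distrib matrix_vector_mult_scaleR inner_add_right
        algebra_simps)
  define Rel where "Rel = {(\<xi>, u, \<eta>). E *v \<eta> = A *v \<xi> + B *v u \<and>
    (\<forall>u0 \<eta>0. E *v \<eta>0 = B *v u0 \<longrightarrow> L \<xi> u u0 \<eta>0 = 0)}"
  have "subspace Rel"
    by (auto simp: Rel_def subspace_def zero_prod_def matrix_vector_right_distrib
        matrix_vector_mult_scaleR scaleR_add_right L)
  moreover have "\<exists>y. (\<xi>, y) \<in> Rel" for \<xi>
  proof -
    obtain \<eta>1 u1' where "A *v \<xi> = E *v \<eta>1 + B *v u1'" using surj by blast
    then have "E *v \<eta>1 = A *v \<xi> + B *v (- u1')"
      by (simp add: linear_neg)
    then obtain u1 where 1: "E *v \<eta>1 = A *v \<xi> + B *v u1" by blast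
    define f where "f = (\<lambda>(u, \<eta> :: real ^ 'n). (((1/2) *\<^sub>R (D + transpose D)) *v u, 0 :: real ^
        'n))"
    define b where "b = (C *v \<xi> + (D + transpose D) *v u1, - (P *v \<xi>))"
    define c where "c = u1 \<bullet> (C *v \<xi> + D *v u1) - \<xi> \<bullet> (P *v \<eta>1)"
    have f: "linear f"
      unfolding f_def
      by (rule linearI) (auto simp: matrix_vector_right_distrib matrix_vector_mult_scaleR)
    have fsym: "x \<bullet> f y = f x \<bullet> y" for x y
      by (cases x; cases y)
        (simp add: f_def matrix_vector_mult_add_rdistrib inner_add inner_transpose_mult
          inner_mult_transpose[of _ D] del: transpose_matrix_vector flip:
              scaleR_matrix_vector_assoc)
    \<comment> \<open>On the admissible affine set through \<open>(u1, \<eta>1)\<close> this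
      quadratic is the slack in \<open>diss\<close>.\<close>
    have bound: "0 \<le> s \<bullet> f s + b \<bullet> s + c" if "s \<in> S" for s
    proof -
      obtain u0 \<eta>0 where s: "s = (u0, \<eta>0)" by (cases s)
      have "E *v (\<eta>1 + \<eta>0) = A *v \<xi> + B *v (u1 + u0)"
        using 1 that by (simp add: S_def s matrix_vector_right_distrib)
      note d = diss[OF this]
      have "s \<bullet> f s = u0 \<bullet> (D *v u0)"
        by (simp add: s f_def inner_add_right matrix_vector_mult_add_rdistrib inner_transpose_mult
            inner_commute[of "D *v u0"] del: transpose_matrix_vector flip:
                scaleR_matrix_vector_assoc)
      moreover have "b \<bullet> s = u0 \<bullet> (C *v \<xi>) + u0 \<bullet> (D *v u1) + u1 \<bullet> (D *v u0) - \<xi> \<bullet> (P *v \<eta>0)"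
      proof -
        have "(transpose D *v u1) \<bullet> u0 = u1 \<bullet> (D *v u0)"
          by (simp add: inner_mult_transpose del: transpose_matrix_vector)
        then show ?thesis
          by (simp add: s b_def inner_add_left matrix_vector_mult_add_rdistrib Psym
              inner_commute[of u0]
              del: transpose_matrix_vector)
      qed
      ultimately show ?thesis
        using d by (simp add: c_def matrix_vector_right_distrib inner_add_left inner_add_right)
    qed
    obtain s where s: "s \<in> S" "\<And>w. w \<in> S \<Longrightarrow> w \<bullet> (2 *\<^sub>R f s + b) = 0"
      using stationary_point_exists[OF S f fsym bound] by blast
    obtain u2 \<eta>2 where s2: "s = (u2, \<eta>2)" by (cases s)
    have "(\<xi>, u1 + u2, \<eta>1 + \<eta>2) \<in> Rel"
      unfolding Rel_def
    proof (clarify, intro conjI allI impI)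
      show "E *v (\<eta>1 + \<eta>2) = A *v \<xi> + B *v (u1 + u2)"
        using 1 s(1) by (simp add: S_def s2 matrix_vector_right_distrib)
      fix u0 \<eta>0 assume "E *v \<eta>0 = B *v u0"
      then have "(u0, \<eta>0) \<bullet> (2 *\<^sub>R f s + b) = 0" by (intro s(2)) (simp add: S_def)
      then show "L \<xi> (u1 + u2) u0 \<eta>0 = 0"
        by (simp add: L_def s2 f_def b_def inner_add_right matrix_vector_right_distrib
           flip: scaleR_matrix_vector_assoc)
    qed
    then show ?thesis by blast
  qed
  ultimately obtain kh where kh: "linear kh" "\<And>\<xi>. (\<xi>, kh \<xi>) \<in> Rel"
    by (rule linear_selection) blast
  define k where "k \<xi> = fst (kh \<xi>)" for \<xi>
  have k: "linear k" unfolding k_def using kh(1) by (intro linearI) (auto simp: linear_add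
      linear_scale)
  have k1: "\<exists>\<eta>. E *v \<eta> = A *v \<xi> + B *v k \<xi>"
   and k2: "\<And>u0 \<eta>0. E *v \<eta>0 = B *v u0 \<Longrightarrow> u0 \<bullet> (C *v \<xi> + (D + transpose D) *v k \<xi>) = \<eta>0 \<bullet> (P *v \<xi>)"
       for \<xi>
    using kh(2)[of \<xi>] by (auto simp: Rel_def L_def k_def split: prod.splits)
  define \<Gamma> where "\<Gamma> \<xi> = C *v \<xi> + (D + transpose D) *v k \<xi>" for \<xi>
  \<comment> \<open>The first equation is \<open>transpose E ** Q = P\<close>, the second prescribes
    the cross term \<open>\<Gamma>\<close>. They are jointly solvable for \<open>q\<close> exactly
    when the right-hand sides annihilate the kernel of \<open>[E, B]\<close>, and this is the
    stationarity \<open>k2\<close>.\<close>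
  define Rel2 where "Rel2 = {(\<xi>, q). transpose E *v q = P *v \<xi> \<and> transpose B *v q = \<Gamma> \<xi>}"
  have "subspace Rel2"
    by (auto simp: Rel2_def \<Gamma>_def subspace_def zero_prod_def linear_0[OF k] linear_add[OF k]
        linear_scale[OF k] matrix_vector_right_distrib
        matrix_vector_mult_scaleR scaleR_add_right simp del: transpose_matrix_vector)
  moreover have "\<exists>q. (\<xi>, q) \<in> Rel2" for \<xi>
  proof -
    have "linear (\<lambda>q. (transpose E *v q, transpose B *v q))"
      by (rule linearI) (auto simp: matrix_vector_right_distrib matrix_vector_mult_scaleR  simp
          del: transpose_matrix_vector)
    then have "subspace (range (\<lambda>q. (transpose E *v q, transpose B *v q)))"
      by (rule linear_subspace_image) simp
    moreover have "z \<bullet> (P *v \<xi>, \<Gamma> \<xi>) = 0"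
      if z: "\<And>s. s \<in> range (\<lambda>q. (transpose E *v q, transpose B *v q)) \<Longrightarrow> z \<bullet> s = 0" for z
    proof -
      obtain a d where ad: "z = (a, d)" by (cases z)
      have "(E *v a + B *v d) \<bullet> q = 0" for q
        using z[of "(transpose E *v q, transpose B *v q)"]
        by (simp add: ad inner_transpose_mult inner_add_left del: transpose_matrix_vector)
      then have "E *v a + B *v d = 0" by (metis inner_eq_zero_iff)
      then have "E *v (- a) = B *v d" by (simp add: linear_neg neg_eq_iff_add_eq_0)
      from k2[OF this, of \<xi>] show ?thesis by (simp add: ad \<Gamma>_def)
    qed
    ultimately have "(P *v \<xi>, \<Gamma> \<xi>) \<in> range (\<lambda>q. (transpose E *v q, transpose B *v q))"
      by (rule mem_subspace_if_annihilated)
    then show ?thesis unfolding Rel2_def by auto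
  qed
  ultimately obtain q where q: "linear q" "\<And>\<xi>. (\<xi>, q \<xi>) \<in> Rel2"
    by (rule linear_selection) blast
  define Q where "Q = matrix q"
  have Q: "Q *v \<xi> = q \<xi>" for \<xi> unfolding Q_def using q(1) by (simp add: matrix_works)
  have QE: "transpose E *v (Q *v \<xi>) = P *v \<xi>" and QB: "transpose B *v (Q *v \<xi>) = \<Gamma> \<xi>" for \<xi>
    using q(2)[of \<xi>] by (simp_all add: Q Rel2_def del: transpose_matrix_vector)
  have EQ: "(Q *v \<xi>) \<bullet> (E *v \<eta>) = \<xi> \<bullet> (P *v \<eta>)" for \<xi> \<eta>
    by (metis QE Psym inner_mult_transpose)
  have BQ: "(Q *v \<xi>) \<bullet> (B *v u) = u \<bullet> \<Gamma> \<xi>" for \<xi> u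
    by (metis QB inner_commute inner_mult_transpose)
  show thesis
  proof
    show "transpose E ** Q = P"
      by (metis QE matrix_eq matrix_vector_mul_assoc)
    fix \<xi> u
    obtain \<eta> where \<eta>: "E *v \<eta> = A *v \<xi> + B *v k \<xi>" using k1 by blast
    define w where "w = u - k \<xi>"
    have u: "u = k \<xi> + w" by (simp add: w_def)
    have "(Q *v \<xi>) \<bullet> (A *v \<xi> + B *v u) = (Q *v \<xi>) \<bullet> (E *v \<eta>) + (Q *v \<xi>) \<bullet> (B *v w)"
      by (simp add: \<eta> u matrix_vector_right_distrib inner_add_right)
    also have "\<dots> = \<xi> \<bullet> (P *v \<eta>) + w \<bullet> \<Gamma> \<xi>" by (simp add: EQ BQ)
    also have "\<dots> \<le> k \<xi> \<bullet> (C *v \<xi> + D *v k \<xi>) + w \<bullet> \<Gamma> \<xi> + w \<bullet> (D *v w)"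
      using diss[OF \<eta>] D[of w] by simp
    also have "\<dots> = u \<bullet> (C *v \<xi> + D *v u)"
      by (simp add: \<Gamma>_def u inner_add matrix_vector_right_distrib matrix_vector_mult_add_rdistrib
          inner_transpose_mult inner_commute del: transpose_matrix_vector)
    finally show "(Q *v \<xi>) \<bullet> (A *v \<xi> + B *v u) \<le> u \<bullet> (C *v \<xi> + D *v u)" .
  qed
qed

section \<open>Quadratic forms from the parallelogram inequality\<close>

text \<open>Subtracting \<open>t * f 1\<close> leaves an additive function of period 1. One period
  bounds it everywhere, yet its value at \<open>n * t\<close> is \<open>n\<close> times that at
  \<open>t\<close>, so it vanishes.\<close>

lemma additive_bounded_real_linear:
  fixes f :: "real \<Rightarrow> real"
  assumes add: "\<And>s t. f (s + t) = f s + f t" and bound: "\<And>t. \<bar>t\<bar> \<le> 1 \<Longrightarrow> \<bar>f t\<bar> \<le> M"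
  shows "f t = t * f 1"
proof -
  define d where "d t = f t - t * f 1" for t
  have d_add: "d (s + t) = d s + d t" for s t by (simp add: d_def add algebra_simps)
  have d0: "d 0 = 0" using d_add[of 0 0] by simp
  have d1: "d 1 = 0" by (simp add: d_def)
  have d_nat: "d (of_nat n * t) = of_nat n * d t" for n t
    by (induction n) (auto simp: d0 d_add algebra_simps)
  have d_neg: "d (- t) = - d t" for t using d_add[of t "- t"] d0 by simp
  have d_int: "d (of_int i) = 0" for i
    by (cases i rule: int_cases2) (use d_nat[of _ 1] d1 in \<open>auto simp: d_neg\<close>)
  have d_bound: "\<bar>d t\<bar> \<le> M + \<bar>f 1\<bar>" for t
  proof -
    have "d t = d (frac t)" using d_add[of "of_int \<lfloor>t\<rfloor>" "frac t"] d_int by (simp add: frac_def)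
    moreover have "\<bar>f (frac t)\<bar> \<le> M" by (rule bound) (simp add: frac_lt_1 less_imp_le)
    moreover have "\<bar>frac t * f 1\<bar> \<le> \<bar>f 1\<bar>"
      by (simp add: abs_mult frac_lt_1 less_imp_le mult_left_le_one_le)
    ultimately show ?thesis unfolding d_def by linarith
  qed
  have "d t = 0"
  proof (rule ccontr)
    assume "d t \<noteq> 0"
    then obtain n where "M + \<bar>f 1\<bar> < of_nat n * \<bar>d t\<bar>" using reals_Archimedean3[of "\<bar>d t\<bar>"] by auto
    then show False using d_bound[of "of_nat n * t"] by (simp add: d_nat abs_mult)
  qed
  then show ?thesis by (simp add: d_def)
qed

text \<open>Jordan-von Neumann from half of the parallelogram law: applying it to
  \<open>x + y\<close> and \<open>x - y\<close> and using homogeneity gives the other half.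
  Nonnegativity bounds the polar form \<open>b\<close>, which upgrades additivity to real
  homogeneity.\<close>

lemma parallelogram_quadratic_form:
  fixes V :: "real ^ 'n \<Rightarrow> real"
  assumes nonneg: "\<And>x. 0 \<le> V x" and scale: "\<And>t x. V (t *\<^sub>R x) = t\<^sup>2 * V x"
    and par: "\<And>x y. V (x + y) + V (x - y) \<le> 2 * V x + 2 * V y"
  obtains P where "psd P" "\<And>x. V x = x \<bullet> (P *v x)"
proof -
  have pareq: "V (x + y) + V (x - y) = 2 * V x + 2 * V y" for x y
  proof (rule antisym[OF par])
    have "V ((x + y) + (x - y)) + V ((x + y) - (x - y)) \<le> 2 * V (x + y) + 2 * V (x - y)" by (rule
        par)
    moreover have "(x + y) + (x - y) = 2 *\<^sub>R x" "(x + y) - (x - y) = 2 *\<^sub>R y"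
      by (simp_all add: scaleR_2)
    ultimately show "2 * V x + 2 * V y \<le> V (x + y) + V (x - y)" by (simp add: scale)
  qed
  define b where "b x y = (V (x + y) - V (x - y)) / 4" for x y
  have V0: "V 0 = 0" using scale[of 0 0] by simp
  have Vneg: "V (- x) = V x" for x using scale[of "-1" x] by simp
  have b_sym: "b x y = b y x" for x y
    using Vneg[of "x - y"] by (simp add: b_def add.commute)
  have b0: "b 0 y = 0" for y by (simp add: b_def Vneg)
  \<comment> \<open>The laws for \<open>(x + y, z + y)\<close> and \<open>(x - y, z - y)\<close> are
    subtracted; \<open>V (x - z)\<close> cancels.\<close>
  have half: "b x y + b z y = b (x + z) (2 *\<^sub>R y) / 2" for x y z
  proof -
    have "x + y + (z + y) = x + z + (y + y)" "x + y - (z + y) = x - z"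
      "x - y + (z - y) = x + z - (y + y)" "x - y - (z - y) = x - z"
      by simp_all
    with pareq[of "x + y" "z + y"] pareq[of "x - y" "z - y"] show ?thesis
      unfolding b_def scaleR_2 by (simp add: field_simps)
  qed
  have b_add: "b (x + z) y = b x y + b z y" for x y z
    using half[of x y z] half[of "x + z" y 0] by (simp add: b0)
  have b_bound: "\<bar>b x y\<bar> \<le> (V x + V y) / 2" for x y
    using pareq[of x y] nonneg[of "x + y"] nonneg[of "x - y"]
    by (simp add: b_def abs_le_iff)
  have b_scale: "b (t *\<^sub>R x) y = t * b x y" for t x y
  proof -
    have "b (t *\<^sub>R x) y = t * b (1 *\<^sub>R x) y"
    proof (rule additive_bounded_real_linear[where f = "\<lambda>t. b (t *\<^sub>R x) y" and M = "V x + V y"])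
      show "b ((s + t) *\<^sub>R x) y = b (s *\<^sub>R x) y + b (t *\<^sub>R x) y" for s t
        by (simp add: scaleR_add_left b_add)
      fix t :: real assume "\<bar>t\<bar> \<le> 1"
      then have "t\<^sup>2 \<le> 1" by (simp add: abs_square_le_1)
      then have "t\<^sup>2 * V x \<le> V x" using nonneg[of x] by (simp add: mult_left_le_one_le)
      then show "\<bar>b (t *\<^sub>R x) y\<bar> \<le> V x + V y"
        using b_bound[of "t *\<^sub>R x" y] nonneg[of x] nonneg[of y] by (simp add: scale)
    qed
    then show ?thesis by simp
  qed
  have b_linear: "linear (\<lambda>x. b x y)" for y by (rule linearI) (simp_all add: b_add b_scale)
  define P where "P = matrix (\<lambda>x. \<chi> i. b (axis i 1) x)"
  have Px: "P *v x = (\<chi> i. b (axis i 1) x)" for x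
  proof -
    have "linear (\<lambda>x. \<chi> i. b (axis i 1) x)"
      by (rule linearI) (simp_all add: vec_eq_iff b_sym[of "axis _ 1"] b_add b_scale)
    then show ?thesis unfolding P_def by (simp add: matrix_works)
  qed
  have P: "y \<bullet> (P *v x) = b y x" for x y
  proof -
    have "y \<bullet> (P *v x) = (\<Sum>i\<in>UNIV. b (y $ i *\<^sub>R axis i 1) x)"
      by (simp add: Px inner_vec_def b_scale)
    also have "\<dots> = b (\<Sum>i\<in>UNIV. y $ i *\<^sub>R axis i 1) x"
      by (simp add: linear_sum[OF b_linear])
    also have "(\<Sum>i\<in>UNIV. y $ i *\<^sub>R axis i 1) = y"
      by (simp add: basis_expansion flip: scalar_mult_eq_scaleR)
    finally show ?thesis .
  qed
  have V: "V x = x \<bullet> (P *v x)" for x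
    using scale[of 2 x] by (simp add: P b_def V0 scaleR_2)
  have "transpose P = P"
  proof -
    have "x \<bullet> (transpose P *v y) = x \<bullet> (P *v y)" for x y
      by (metis P b_sym inner_commute inner_transpose_mult)
    then have "transpose P *v y = P *v y" for y by (metis vector_eq_ldot)
    then show ?thesis by (simp add: matrix_eq)
  qed
  then have "psd P" using V nonneg by (simp add: psd_def)
  then show thesis using V that by blast
qed

section \<open>Discrete-time passivity and the required supply\<close>

text \<open>Cauchy's formula for derivatives on a circle of radius below 1, since nothing is known
  on the boundary. For \<open>j > k\<close> the factor is a positive power of \<open>e t\<close>,
  and is absorbed into a holomorphic function vanishing at 0.\<close>

lemma circle_fourier_coefficient:
  fixes f :: "complex \<Rightarrow> complex"
  assumes f: "f holomorphic_on ball 0 1" and a: "f has_fps_expansion a" and r: "0 < r" "r < 1"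
  defines "e \<equiv> \<lambda>t :: real. exp (2 * of_real pi * \<i> * of_real t)"
  shows "((\<lambda>t. f (of_real r * e t) * (cnj (e t) ^ k * e t ^ j)) has_integral
    (if j \<le> k then of_real r ^ (k - j) * fps_nth a (k - j) else 0)) {0..1}"
proof -
  have e_nz: "e t \<noteq> 0" for t by (simp add: e_def)
  have e_cnj: "cnj (e t) * e t = 1" for t
    by (simp add: e_def exp_cnj flip: exp_add)
  have coeff: "(deriv ^^ l) f 0 / fact l = fps_nth a l" for l
    using fps_nth_fps_expansion[OF a] by simp
  have cauchy: "((\<lambda>t. g (of_real r * e t) / e t ^ l) has_integral of_real r ^ l * ((deriv ^^ l) g
      0 / fact l)) {0..1}"
    if g: "g holomorphic_on ball 0 1" for g l
  proof -
    have sub: "cball 0 r \<subseteq> ball (0::complex) 1" using r by auto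
    have "((\<lambda>u. g u / (u - 0) ^ Suc l) has_contour_integral
        (2 * pi * \<i>) / fact l * (deriv ^^ l) g 0) (circlepath 0 r)"
      by (rule Cauchy_has_contour_integral_higher_derivative_circlepath)
        (use r g sub in \<open>auto intro: holomorphic_on_subset holomorphic_on_imp_continuous_on
          order_trans[OF ball_subset_cball]\<close>)
    then have "((\<lambda>x. g (circlepath 0 r x) / (circlepath 0 r x - 0) ^ Suc l *
        vector_derivative (circlepath 0 r) (at x within {0..1})) has_integral
        (2 * pi * \<i>) / fact l * (deriv ^^ l) g 0) {0..1}"
      by (simp add: has_contour_integral_def)
    then have "((\<lambda>x. g (of_real r * e x) / (of_real r * e x) ^ Suc l * (2 * pi * \<i> * r * e x))
        has_integral
        (2 * pi * \<i>) / fact l * (deriv ^^ l) g 0) {0..1}"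
    proof (rule has_integral_eq[rotated])
      fix x :: real assume "x \<in> {0..1}"
      then have "vector_derivative (circlepath 0 r) (at x within {0..1}) = 2 * pi * \<i> * r * e x"
        by (simp add: vector_derivative_circlepath01 e_def mult_ac)
      moreover have "circlepath 0 r x = of_real r * e x" by (simp add: circlepath e_def)
      ultimately show "g (circlepath 0 r x) / (circlepath 0 r x - 0) ^ Suc l *
          vector_derivative (circlepath 0 r) (at x within {0..1})
        = g (of_real r * e x) / (of_real r * e x) ^ Suc l * (2 * pi * \<i> * r * e x)"
        by (simp only: diff_zero)
    qed
    then have "((\<lambda>x. of_real r ^ l / (2 * pi * \<i>) *
          (g (of_real r * e x) / (of_real r * e x) ^ Suc l * (2 * pi * \<i> * r * e x)))
        has_integral of_real r ^ l / (2 * pi * \<i>) * ((2 * pi * \<i>) / fact l * (deriv ^^ l) g 0))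
            {0..1}"
      by (rule has_integral_mult_right)
    then show ?thesis
      using r e_nz by (simp add: field_simps)
  qed
  show ?thesis
  proof (cases "j \<le> k")
    case True
    have "cnj (e t) ^ k * e t ^ j = 1 / e t ^ (k - j)" for t
    proof -
      have "cnj (e t) ^ k * e t ^ j = cnj (e t) ^ (k - j) * (cnj (e t) * e t) ^ j"
        using True by (simp add: power_mult_distrib flip: power_add mult.assoc)
      moreover have "cnj (e t) ^ (k - j) * e t ^ (k - j) = 1"
        by (simp add: e_cnj flip: power_mult_distrib)
      ultimately show ?thesis using e_nz e_cnj by (simp add: eq_divide_eq)
    qed
    then show ?thesis using cauchy[OF f, of "k - j"] True by (simp add: coeff)
  next
    case False
    have *: "cnj (e t) ^ k * e t ^ j = e t ^ (j - k)" for t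
    proof -
      have "cnj (e t) ^ k * e t ^ j = (cnj (e t) * e t) ^ k * e t ^ (j - k)"
        using False by (simp add: power_mult_distrib mult.assoc flip: power_add)
      then show ?thesis by (simp add: e_cnj)
    qed
    have "(\<lambda>z. f z * z ^ (j - k)) holomorphic_on ball 0 1" using f by (intro holomorphic_intros)
    from cauchy[OF this, of 0] False
    have "((\<lambda>t. f (of_real r * e t) * (of_real r * e t) ^ (j - k)) has_integral 0) {0..1}"
      by (simp add: power_0_left not_le)
    then have "((\<lambda>t. 1 / of_real r ^ (j - k) * (f (of_real r * e t) * (of_real r * e t) ^ (j - k)))
        has_integral 1 / of_real r ^ (j - k) * 0) {0..1}"
      by (rule has_integral_mult_right)
    then show ?thesis using False r by (simp add: * power_mult_distrib)
  qed
qed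

text \<open>The form of \<open>M\<close> plus its adjoint is twice the real part of the form of
  \<open>M\<close>.\<close>

lemma hermitian_psd_add_transpose:
  assumes "hermitian_psd (M + hermitian_transpose M)"
  shows "0 \<le> Re (\<Sum>i\<in>UNIV. \<Sum>j\<in>UNIV. cnj (x $ i) * (M $ i $ j * x $ j))" (is "0 \<le> Re ?f")
proof -
  have "(\<Sum>i\<in>UNIV. \<Sum>j\<in>UNIV. cnj (x $ i) * (cnj (M $ j $ i) * x $ j)) = cnj ?f"
    by (subst sum.swap) (simp add: mult_ac)
  moreover have "(\<Sum>i\<in>UNIV. cnj (x $ i) * ((M + hermitian_transpose M) *v x) $ i)
     = ?f + (\<Sum>i\<in>UNIV. \<Sum>j\<in>UNIV. cnj (x $ i) * (cnj (M $ j $ i) * x $ j))"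
    by (simp add: hermitian_transpose_def transpose_def matrix_vector_mult_def sum_distrib_left
        algebra_simps sum.distrib)
  moreover have "0 \<le> Re (\<Sum>i\<in>UNIV. cnj (x $ i) * ((M + hermitian_transpose M) *v x) $ i)"
    using assms by (simp add: hermitian_psd_def)
  ultimately have "0 \<le> Re (?f + cnj ?f)" by (simp only:)
  then show ?thesis unfolding plus_complex.sel cnj.sel by linarith
qed

text \<open>The Caratheodory-Toeplitz inequality. For the trigonometric polynomial \<open>v\<close>
  with coefficients \<open>u k\<close>, the mean of the form of \<open>F\<close> at \<open>v\<close>
  over the circle of radius \<open>r\<close> is the sum with \<open>h (k - l)\<close> damped by
  \<open>r ^ (k - l)\<close>. The sum is finite, so \<open>r\<close> may tend to 1.\<close>

lemma toeplitz_form_nonneg: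
  fixes F :: "complex \<Rightarrow> complex ^ 'm ^ 'm" and h :: "nat \<Rightarrow> real ^ 'm ^ 'm" and u :: "nat \<Rightarrow> real ^
      'm"
  assumes hol: "\<And>i j. (\<lambda>z. F z $ i $ j) holomorphic_on ball 0 1"
    and psd: "\<And>z. norm z < 1 \<Longrightarrow> hermitian_psd (F z + hermitian_transpose (F z))"
    and h: "\<And>i j. (\<lambda>z. F z $ i $ j) has_fps_expansion Abs_fps (\<lambda>l. of_real (h l $ i $ j))"
  shows "0 \<le> (\<Sum>k<N. \<Sum>l\<le>k. u k \<bullet> (h (k - l) *v u l))"
proof -
  define e where "e t = exp (2 * of_real pi * \<i> * of_real t)" for t :: real
  define T where "T r = (\<Sum>k<N. \<Sum>l\<le>k. r ^ (k - l) * (u k \<bullet> (h (k - l) *v u l)))" for r :: real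
  have T_nonneg: "0 \<le> T r" if r: "0 < r" "r < 1" for r
  proof -
    define v where "v t = (\<chi> i. \<Sum>k<N. of_real (u k $ i) * e t ^ k)" for t
    define \<Phi> where "\<Phi> t = (\<Sum>i\<in>UNIV. \<Sum>j\<in>UNIV. cnj (v t $ i) * (F (of_real r * e t) $ i $ j * v t $
        j))" for t
    define c where "c i j k l = (if l \<le> k then of_real r ^ (k - l) * of_real (h (k - l) $ i $ j)
        else 0 :: complex)"
      for i j k l
    have prod: "cnj (v t $ i) * (a * v t $ j) = (\<Sum>k<N. \<Sum>l<N. of_real (u k $ i * u l $ j) *
        (a * (cnj (e t) ^ k * e t ^ l)))" for t i j a
    proof -
      have "cnj (v t $ i) * (a * v t $ j)
          = (\<Sum>k<N. of_real (u k $ i) * cnj (e t) ^ k) * (\<Sum>l<N. a * (of_real (u l $ j) * e t ^ l))"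
        by (simp add: v_def sum_distrib_left)
      then show ?thesis unfolding sum_product by (simp add: mult_ac)
    qed
    have \<Phi>: "\<Phi> = (\<lambda>t. \<Sum>i\<in>UNIV. \<Sum>j\<in>UNIV. \<Sum>k<N. \<Sum>l<N. of_real (u k $ i * u l $ j) *
        (F (of_real r * e t) $ i $ j * (cnj (e t) ^ k * e t ^ l)))"
      by (simp add: \<Phi>_def prod fun_eq_iff)
    have coeff: "((\<lambda>t. F (of_real r * e t) $ i $ j * (cnj (e t) ^ k * e t ^ l)) has_integral c i j
        k l) {0..1}"
      for i j k l
      using circle_fourier_coefficient[of "\<lambda>z. F z $ i $ j" _ r k l, OF hol h r]
      unfolding c_def e_def fps_nth_Abs_fps .
    have "(\<Phi> has_integral (\<Sum>i\<in>UNIV. \<Sum>j\<in>UNIV. \<Sum>k<N. \<Sum>l<N. of_real (u k $ i * u l $ j) * c i j k l))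
        {0..1}"
      unfolding \<Phi> by (intro has_integral_sum has_integral_mult_right coeff) auto
    moreover have "(\<Sum>i\<in>UNIV. \<Sum>j\<in>UNIV. \<Sum>k<N. \<Sum>l<N. of_real (u k $ i * u l $ j) * c i j k l) =
        of_real (T r)"
    proof -
      have "(\<Sum>i\<in>UNIV. \<Sum>j\<in>UNIV. \<Sum>k<N. \<Sum>l<N. of_real (u k $ i * u l $ j) * c i j k l)
          = (\<Sum>k<N. \<Sum>l<N. \<Sum>i\<in>UNIV. \<Sum>j\<in>UNIV. of_real (u k $ i * u l $ j) * c i j k l)"
        by (simp only: sum.swap[of _ "{..<N}" UNIV])
      also have "\<dots> = (\<Sum>k<N. \<Sum>l\<in>{..<N} \<inter> {..k}. of_real (r ^ (k - l) * (u k \<bullet> (h (k - l) *v u l))))"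
        by (rule sum.cong[OF refl], subst sum.inter_restrict)
          (auto simp: c_def inner_vec_def matrix_vector_mult_def sum_distrib_left mult_ac intro!:
              sum.cong)
      also have "\<dots> = (\<Sum>k<N. \<Sum>l\<le>k. of_real (r ^ (k - l) * (u k \<bullet> (h (k - l) *v u l))))"
        by (intro sum.cong) auto
      finally show ?thesis by (simp add: T_def)
    qed
    ultimately have "(\<Phi> has_integral of_real (T r)) {0..1}" by simp
    from has_integral_linear[OF this bounded_linear_Re]
    have "((\<lambda>t. Re (\<Phi> t)) has_integral T r) {0..1}" by (simp add: o_def)
    moreover have "0 \<le> Re (\<Phi> t)" for t
    proof -
      have "norm (of_real r * e t) < 1" using r by (simp add: e_def norm_mult)
      then show ?thesis unfolding \<Phi>_def by (intro hermitian_psd_add_transpose psd)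
    qed
    ultimately show ?thesis by (rule has_integral_nonneg)
  qed
  have "isCont T 1" unfolding T_def by (intro continuous_intros)
  then have "(T \<longlongrightarrow> T 1) (at_left 1)" unfolding isCont_def by (rule filterlim_at_split[THEN iffD1,
      THEN conjunct1])
  moreover have "eventually (\<lambda>r. 0 \<le> T r) (at_left 1)"
    unfolding eventually_at_left[OF zero_less_one] by (rule exI[of _ 0]) (use T_nonneg in auto)
  ultimately have "0 \<le> T 1" by (rule tendsto_lowerbound) simp
  then show ?thesis by (simp add: T_def)
qed

section \<open>Trajectories from rest, their supply and reachability\<close>

primrec traj :: "real ^ 'n ^ 'n \<Rightarrow> real ^ 'm ^ 'n \<Rightarrow> (nat \<Rightarrow> real ^ 'm) \<Rightarrow> nat \<Rightarrow> real ^ 'n" where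
  "traj A B u 0 = 0"
| "traj A B u (Suc k) = A *v traj A B u k + B *v u k"

definition total_supply :: "real ^ 'n ^ 'n \<Rightarrow> real ^ 'm ^ 'n \<Rightarrow> real ^ 'n ^ 'm \<Rightarrow> real ^ 'm ^ 'm
    \<Rightarrow> (nat \<Rightarrow> real ^ 'm) \<Rightarrow> nat \<Rightarrow> real" where
  "total_supply A B C D u N = (\<Sum>k<N. u k \<bullet> (C *v traj A B u k + D *v u k))"

lemma traj_add: "traj A B (\<lambda>k. u k + v k) N = traj A B u N + traj A B v N"
  by (induction N) (simp_all add: matrix_vector_right_distrib)

lemma traj_diff: "traj A B (\<lambda>k. u k - v k) N = traj A B u N - traj A B v N"
  by (induction N) (simp_all add: matrix_vector_mult_diff_distrib)

lemma traj_scale: "traj A B (\<lambda>k. t *\<^sub>R u k) N = t *\<^sub>R traj A B u N"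
  by (induction N) (simp_all add: matrix_vector_mult_scaleR scaleR_add_right)

text \<open>Starting from rest, the state is linear in the input, so the supply is a quadratic form
  in the input.\<close>

lemma total_supply_parallelogram:
  "total_supply A B C D (\<lambda>k. u k + v k) N + total_supply A B C D (\<lambda>k. u k - v k) N
    = 2 * total_supply A B C D u N + 2 * total_supply A B C D v N"
  unfolding total_supply_def sum_distrib_left sum.distrib[symmetric]
  by (intro sum.cong refl)
    (simp add: traj_add traj_diff matrix_vector_right_distrib matrix_vector_mult_diff_distrib
      inner_add_left inner_add_right inner_diff_left inner_diff_right)

lemma total_supply_scale: "total_supply A B C D (\<lambda>k. t *\<^sub>R u k) N = t\<^sup>2 * total_supply A B C D u N"
  by (simp add: total_supply_def traj_scale matrix_vector_mult_scaleR sum_distrib_left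
      power2_eq_square mult.assoc
      flip: scaleR_add_right)

text \<open>Idling at rest costs nothing and keeps the state at zero; this lets inputs of different
  lengths end at the same time.\<close>

definition delay :: "nat \<Rightarrow> (nat \<Rightarrow> 'a::zero) \<Rightarrow> nat \<Rightarrow> 'a" where
  "delay d u k = (if k < d then 0 else u (k - d))"

lemma traj_delay_zero: "k \<le> d \<Longrightarrow> traj A B (delay d u) k = 0"
  by (induction k) (simp_all add: delay_def)

lemma traj_delay: "traj A B (delay d u) (d + k) = traj A B u k"
proof (induction k)
  case 0
  show ?case by (simp add: traj_delay_zero)
next
  case (Suc k)
  have "delay d u (d + k) = u k" by (simp add: delay_def)
  with Suc show ?case by simp
qed

lemma total_supply_delay: "total_supply A B C D (delay d u) (d + N) = total_supply A B C D u N"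
proof (induction N)
  case 0
  show ?case by (simp add: total_supply_def delay_def)
next
  case (Suc N)
  then show ?case by (simp add: total_supply_def traj_delay) (simp add: delay_def)
qed

lemma traj_cong: "(\<And>k. k < N \<Longrightarrow> u k = v k) \<Longrightarrow> traj A B u N = traj A B v N"
  by (induction N) simp_all

lemma total_supply_cong:
  assumes "\<And>k. k < N \<Longrightarrow> u k = v k"
  shows "total_supply A B C D u N = total_supply A B C D v N"
proof -
  have "traj A B u k = traj A B v k" if "k < N" for k
    using that assms by (intro traj_cong) auto
  then show ?thesis using assms by (simp add: total_supply_def)
qed

text \<open>Each input is delayed by the length of the other.\<close>

lemma common_horizon:
  obtains N u' v' where "traj A B u' N = traj A B u M1" "traj A B v' N = traj A B v M2"
    "total_supply A B C D u' N = total_supply A B C D u M1" "total_supply A B C D v' N =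
        total_supply A B C D v M2"
proof
  show "traj A B (delay M2 u) (M2 + M1) = traj A B u M1"
    "total_supply A B C D (delay M2 u) (M2 + M1) = total_supply A B C D u M1"
    by (rule traj_delay total_supply_delay)+
  show "traj A B (delay M1 v) (M2 + M1) = traj A B v M2"
    "total_supply A B C D (delay M1 v) (M2 + M1) = total_supply A B C D v M2"
    using traj_delay[of A B M1 v M2] total_supply_delay[of A B C D M1 v M2] by (simp_all add:
        add.commute)
qed

text \<open>The orthogonal complement of the reachable set is invariant under
  \<open>transpose A\<close> and killed by \<open>transpose B\<close>; if nonzero, it would contain
  an eigenvector that the Hautus condition excludes.\<close>

lemma reachable:
  fixes A :: "real ^ 'n ^ 'n" and B :: "real ^ 'm ^ 'n"
  assumes ctrl: "\<And>w \<mu>. cmat (transpose A) *v w = \<mu> *s w \<Longrightarrow> cmat (transpose B) *v w = 0 \<Longrightarrow> w = 0"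
  shows "\<exists>u N. traj A B u N = x"
proof -
  define R where "R = {traj A B u N |u N. True}"
  define S where "S = R\<^sup>\<bottom>"
  have SD: "r \<bullet> w = 0" if "w \<in> S" "r \<in> R" for r w
    using that by (simp add: S_def orthogonal_comp_def orthogonal_def)
  have R: "subspace R"
  proof (rule subspaceI)
    show "0 \<in> R" unfolding R_def using traj.simps(1) by (metis (mono_tags, lifting) mem_Collect_eq)
    fix x y assume "x \<in> R" "y \<in> R"
    then obtain u M1 v M2 where "x = traj A B u M1" "y = traj A B v M2" by (auto simp: R_def)
    then obtain N u' v' where "traj A B u' N = x" "traj A B v' N = y" using common_horizon by metis
    then have "x + y = traj A B (\<lambda>k. u' k + v' k) N" by (simp add: traj_add)
    then show "x + y \<in> R" unfolding R_def by blast
  next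
    fix c x assume "x \<in> R"
    then obtain u N where "x = traj A B u N" by (auto simp: R_def)
    then have "c *\<^sub>R x = traj A B (\<lambda>k. c *\<^sub>R u k) N" by (simp add: traj_scale)
    then show "c *\<^sub>R x \<in> R" unfolding R_def by blast
  qed
  have step: "A *v r + B *v w \<in> R" if r: "r \<in> R" for r w
  proof -
    obtain u N where r': "r = traj A B u N" using r by (auto simp: R_def)
    have "A *v r + B *v w = traj A B (u(N := w)) (Suc N)"
      using traj_cong[of N "u(N := w)" u A B] by (simp add: r')
    then show ?thesis unfolding R_def by blast
  qed
  have "w = 0" if w: "w \<in> S" for w
  proof (rule ccontr)
    assume "w \<noteq> 0"
    have S: "subspace S" unfolding S_def by (rule subspace_orthogonal_comp)
    have "transpose A *v y \<in> S" if y: "y \<in> S" for y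
      unfolding S_def orthogonal_comp_def orthogonal_def
    proof clarify
      fix r assume "r \<in> R"
      then have "A *v r \<in> R" using step[of r 0] by simp
      then show "r \<bullet> (transpose A *v y) = 0"
        unfolding inner_transpose_mult using SD y by blast
    qed
    then obtain v \<mu> where v: "v \<noteq> 0" "re_vec v \<in> S" "im_vec v \<in> S"
        "cmat (transpose A) *v v = \<mu> *s v"
      using real_invariant_subspace_eigenvector[OF S w \<open>w \<noteq> 0\<close>] by blast
    have "transpose B *v y = 0" if y: "y \<in> S" for y
    proof -
      have "B *v (transpose B *v y) \<in> R"
        using step[of 0 "transpose B *v y"] subspace_0[OF R] by simp
      then have "(B *v (transpose B *v y)) \<bullet> y = 0" using SD y by blast
      then show ?thesis
        using inner_transpose_mult[of "transpose B *v y" B y] by (simp del: transpose_matrix_vector)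
    qed
    then have "cmat (transpose B) *v v = 0" using v by (intro cmat_mult_eq_0) blast+
    then show False using ctrl v by blast
  qed
  moreover have "z \<in> S" if "\<And>s. s \<in> R \<Longrightarrow> z \<bullet> s = 0" for z
    using that by (simp add: S_def orthogonal_comp_def orthogonal_def inner_commute)
  ultimately have "x \<in> R" by (intro mem_subspace_if_annihilated[OF R]) (metis inner_zero_left)
  then show ?thesis by (auto simp: R_def)
qed

text \<open>The storage function is the required supply: the least total supply over all inputs that steer
  the zero state to \<open>x\<close>.\<close>

lemma quadratic_storage_exists:
  fixes A :: "real ^ 'n ^ 'n" and B :: "real ^ 'm ^ 'n"
  assumes passivity: "\<And>u N. 0 \<le> total_supply A B C D u N" and reach: "\<And>x. \<exists>u N. traj A B u N = x"
  obtains P where "psd P"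
    "\<And>x u. (A *v x + B *v u) \<bullet> (P *v (A *v x + B *v u)) - x \<bullet> (P *v x) \<le> u \<bullet> (C *v x + D *v u)"
proof -
  define W where "W x = {total_supply A B C D u N |u N. traj A B u N = x}" for x
  define V where "V x = Inf (W x)" for x
  have W_ne: "W x \<noteq> {}" for x using reach[of x] by (auto simp: W_def)
  have W_bdd: "bdd_below (W x)" for x unfolding W_def bdd_below_def using passivity by blast
  have V_le: "V x \<le> total_supply A B C D u N" if "traj A B u N = x" for x u N
    unfolding V_def by (rule cInf_lower[OF _ W_bdd]) (use that in \<open>auto simp: W_def\<close>)
  have V_ge: "c \<le> V x" if "\<And>u N. traj A B u N = x \<Longrightarrow> c \<le> total_supply A B C D u N" for c x
    unfolding V_def by (rule cInf_greatest[OF W_ne]) (use that in \<open>auto simp: W_def\<close>)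
  have V_approx: "\<exists>u N. traj A B u N = x \<and> total_supply A B C D u N < V x + \<epsilon>" if "\<epsilon> > 0" for x \<epsilon>
    using cInf_lessD[OF W_ne, of x "V x + \<epsilon>"] that by (force simp: V_def W_def)
  have nonneg: "0 \<le> V x" for x by (rule V_ge) (rule passivity)
  have V0: "V 0 = 0" using V_le[of "\<lambda>_. 0" 0] nonneg[of 0] by (simp add: total_supply_def)
  have scale_le: "V (t *\<^sub>R x) \<le> t\<^sup>2 * V x" if "t \<noteq> 0" for t x
  proof -
    have "V (t *\<^sub>R x) / t\<^sup>2 \<le> V x"
    proof (rule V_ge)
      fix u N assume "traj A B u N = x"
      then have "V (t *\<^sub>R x) \<le> t\<^sup>2 * total_supply A B C D u N"
        using V_le[of "\<lambda>k. t *\<^sub>R u k" N "t *\<^sub>R x"] by (simp add: traj_scale total_supply_scale)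
      then show "V (t *\<^sub>R x) / t\<^sup>2 \<le> total_supply A B C D u N" using that by (simp add: field_simps)
    qed
    then show ?thesis using that by (simp add: field_simps)
  qed
  have scale: "V (t *\<^sub>R x) = t\<^sup>2 * V x" for t x
  proof (cases "t = 0")
    case False
    have "V ((1 / t) *\<^sub>R (t *\<^sub>R x)) \<le> (1 / t)\<^sup>2 * V (t *\<^sub>R x)"
      by (rule scale_le) (use False in simp)
    then have "t\<^sup>2 * V x \<le> V (t *\<^sub>R x)" using False by (simp add: field_simps)
    then show ?thesis using scale_le[OF False, of x] by simp
  qed (simp add: V0)
  have par: "V (x + y) + V (x - y) \<le> 2 * V x + 2 * V y" for x y
  proof (rule field_le_epsilon)
    fix \<epsilon> :: real assume "\<epsilon> > 0"
    \<comment> \<open>The parallelogram identity doubles each of the two errors, which add up to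
      \<open>\<epsilon>\<close>.\<close>
    then have "\<epsilon> / 4 > 0" by simp
    obtain u M1 where u: "traj A B u M1 = x" "total_supply A B C D u M1 < V x + \<epsilon> / 4"
      using V_approx[OF \<open>\<epsilon> / 4 > 0\<close>] by blast
    obtain v M2 where v: "traj A B v M2 = y" "total_supply A B C D v M2 < V y + \<epsilon> / 4"
      using V_approx[OF \<open>\<epsilon> / 4 > 0\<close>] by blast
    obtain N u' v' where N: "traj A B u' N = x" "traj A B v' N = y"
      "total_supply A B C D u' N = total_supply A B C D u M1" "total_supply A B C D v' N =
          total_supply A B C D v M2"
      using common_horizon[of A B u M1 v M2 C D] u(1) v(1) by metis
    have "V (x + y) \<le> total_supply A B C D (\<lambda>k. u' k + v' k) N"
      by (rule V_le) (simp add: traj_add N)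
    moreover have "V (x - y) \<le> total_supply A B C D (\<lambda>k. u' k - v' k) N"
      by (rule V_le) (simp add: traj_diff N)
    ultimately show "V (x + y) + V (x - y) \<le> 2 * V x + 2 * V y + \<epsilon>"
      using total_supply_parallelogram[of A B C D u' v' N] N u(2) v(2) by linarith
  qed
  obtain P where P: "psd P" "\<And>x. V x = x \<bullet> (P *v x)"
    using parallelogram_quadratic_form[OF nonneg scale par] by blast
  \<comment> \<open>Any input reaching \<open>x\<close>, followed by \<open>w\<close>, reaches the
    next state; changing \<open>u\<close> at time \<open>N\<close> does not affect the first
    \<open>N\<close> steps.\<close>
  have "V (A *v x + B *v w) - w \<bullet> (C *v x + D *v w) \<le> V x" for x w
  proof (rule V_ge)
    fix u N assume x: "traj A B u N = x"
    have *: "traj A B (u(N := w)) N = x" using x traj_cong[of N "u(N := w)" u A B] by simp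
    have "V (A *v x + B *v w) \<le> total_supply A B C D (u(N := w)) (Suc N)"
      by (rule V_le) (simp add: *)
    also have "\<dots> = total_supply A B C D (u(N := w)) N + w \<bullet> (C *v x + D *v w)"
      by (simp add: total_supply_def *)
    also have "total_supply A B C D (u(N := w)) N = total_supply A B C D u N" by (rule
        total_supply_cong) simp
    finally show "V (A *v x + B *v w) - w \<bullet> (C *v x + D *v w) \<le> total_supply A B C D u N" by simp
  qed
  then show thesis using that[OF P(1)] P(2) by (simp add: algebra_simps)
qed

section \<open>Regular pencils\<close>

lemma det_pencil_poly:
  fixes E A :: "real ^ 'n ^ 'n"
  obtains p where "\<And>t. det (pencil (\<alpha>0 + t * \<alpha>1) (\<beta>0 + t * \<beta>1) E A) = poly p t"
proof -
  define p where "p = (\<Sum>\<pi> | \<pi> permutes (UNIV :: 'n set). smult (of_int (sign \<pi>))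
    (\<Prod>i\<in>UNIV. [:pencil \<alpha>0 \<beta>0 E A $ i $ \<pi> i, pencil \<alpha>1 \<beta>1 E A $ i $ \<pi> i:]))"
  show thesis
    by (rule that[of p]) (simp add: p_def det_def poly_sum poly_prod pencil_def algebra_simps)
qed

lemma det_pencil_scale:
  fixes E A :: "real ^ 'n ^ 'n"
  shows "det (pencil (c * \<alpha>) (c * \<beta>) E A) = c ^ CARD('n) * det (pencil \<alpha> \<beta> E A)"
proof -
  have "pencil (c * \<alpha>) (c * \<beta>) E A = (\<chi> i. c *s (pencil \<alpha> \<beta> E A $ i))"
    by (simp add: pencil_def vec_eq_iff algebra_simps)
  then show ?thesis by (simp add: det_rows_mul)
qed

text \<open>If the determinant vanished for all \<open>s > 0\<close>, then as a polynomial it would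
  vanish for all \<open>s\<close>; homogeneity extends this to \<open>\<beta> \<noteq> 0\<close>,
  and a second polynomial argument to \<open>\<beta> = 0\<close>. A positive real \<open>s\<close>
  keeps \<open>s E - A\<close> real and lies in the half-plane of
  \<open>positive_real\<close>.\<close>

lemma regular_pencil_positive_point:
  fixes E A :: "real ^ 'n ^ 'n"
  assumes "regular_pencil E A"
  obtains s :: real where "s > 0" "det (pencil (of_real s) 1 E A) \<noteq> 0"
proof -
  have "\<exists>s>0. det (pencil (of_real s) 1 E A) \<noteq> 0"
  proof (rule ccontr)
    assume "\<not> ?thesis"
    then have 0: "det (pencil (of_real s) 1 E A) = 0" if "s > 0" for s :: real
      using that by blast
    have vanish: "p = 0" if "infinite {t. poly p t = 0}" for p :: "complex poly"
      using that poly_roots_finite by blast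
    have 1: "det (pencil \<alpha> 1 E A) = 0" for \<alpha>
    proof -
      obtain p where p: "\<And>t. det (pencil (0 + t * 1) (1 + t * 0) E A) = poly p t"
        using det_pencil_poly by blast
      have "complex_of_real ` {0<..} \<subseteq> {t. poly p t = 0}"
        using 0 p by auto
      moreover have "infinite (complex_of_real ` {0<..})"
        by (simp add: finite_image_iff inj_on_def infinite_Ioi)
      ultimately have "infinite {t. poly p t = 0}" using finite_subset by blast
      then have "p = 0" by (rule vanish)
      then show ?thesis using p[of \<alpha>] by simp
    qed
    have "det (pencil \<alpha> \<beta> E A) = 0" for \<alpha> \<beta>
    proof -
      obtain p where p: "\<And>t. det (pencil (\<alpha> + t * 0) (0 + t * 1) E A) = poly p t"
        using det_pencil_poly by blast
      have "poly p t = 0" if "t \<noteq> 0" for t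
        using det_pencil_scale[of t "\<alpha> / t" 1 E A] that p[of t] 1 by simp
      then have "- {0} \<subseteq> {t. poly p t = 0}" by auto
      moreover have "infinite (- {0 :: complex})"
        by (metis finite.emptyI finite_insert finite_compl infinite_UNIV_char_0)
      ultimately have "infinite {t. poly p t = 0}" using finite_subset by blast
      then have "p = 0" by (rule vanish)
      then show ?thesis using p[of \<beta>] by simp
    qed
    then show False using assms by (simp add: regular_pencil_def)
  qed
  then show ?thesis using that by blast
qed

lemma cmat_pencil: "pencil (of_real s) 1 E A = cmat (s *\<^sub>R E - A)"
  by (simp add: pencil_def vec_eq_iff)

lemma invertible_real_pencil:
  assumes "det (pencil (of_real s) 1 E A) \<noteq> 0"
  shows "invertible (s *\<^sub>R E - A)"
proof -
  have "det (cmat M) = of_real (det M)" for M :: "real ^ 'a ^ 'a"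
    by (simp add: det_def)
  then show ?thesis using assms by (simp add: cmat_pencil invertible_det_nz)
qed

section \<open>Storage matrices and port-Hamiltonian form\<close>

lemma dim_kernel_transpose:
  fixes Q :: "real ^ 'n ^ 'n"
  shows "dim {x. transpose Q *v x = 0} = dim {x. Q *v x = 0}"
proof -
  have ker: "dim {x. M *v x = 0} + rank M = CARD('n)" for M :: "real ^ 'n ^ 'n"
  proof -
    have "{x. M *v x = 0} = {y \<in> UNIV. \<forall>x\<in>range ((*v) (transpose M)). orthogonal x y}" (is "_ = ?K")
      by (auto simp: orthogonal_def inner_commute[of _ "_ :: real ^ 'n"] inner_transpose_mult
          simp del: transpose_matrix_vector) (metis inner_eq_zero_iff inner_commute
              inner_transpose_mult)
    moreover have "dim ?K + dim (range ((*v) (transpose M))) = dim (UNIV :: (real ^ 'n) set)"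
      by (rule dim_subspace_orthogonal_to_vectors)
        (auto intro: linear_subspace_image simp del: transpose_matrix_vector)
    moreover have "dim (range ((*v) (transpose M))) = rank M"
      by (metis rank_dim_range rank_transpose)
    ultimately show ?thesis by simp
  qed
  show ?thesis using ker[of Q] ker[of "transpose Q"] by (simp add: rank_transpose)
qed

text \<open>Along the kernel of \<open>Q\<close> the dissipation inequality is affine, which forces
  \<open>C x = 0\<close> and \<open>Q^T A x = 0\<close>. So \<open>E\<close> and
  \<open>Z = s E - A\<close> map the kernel of \<open>Q\<close> into that of \<open>Q^T\<close>.
  Equal dimensions make \<open>Z\<close> a bijection between them, hence \<open>Z^-1 E\<close>
  preserves the kernel of \<open>Q\<close>, and an eigenvector in it would be unobservable.\<close>

lemma invertible_storage_matrix:
  fixes E A Q :: "real ^ 'n ^ 'n" and B :: "real ^ 'm ^ 'n" and C :: "real ^ 'n ^ 'm"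
  assumes reg: "regular_pencil E A" and obs: "completely_observable E A C"
    and sym: "transpose Q ** E = transpose E ** Q"
    and diss: "\<And>\<xi> u. (Q *v \<xi>) \<bullet> (A *v \<xi> + B *v u) \<le> u \<bullet> (C *v \<xi> + D *v u)"
  shows "invertible Q"
proof -
  obtain s where "det (pencil (of_real s) 1 E A) \<noteq> 0" using regular_pencil_positive_point[OF reg] .
  then have "invertible (s *\<^sub>R E - A)" by (rule invertible_real_pencil)
  define Z where "Z = s *\<^sub>R E - A"
  obtain K where KZ: "K ** Z = mat 1" and ZK: "Z ** K = mat 1"
    using \<open>invertible (s *\<^sub>R E - A)\<close> by (auto simp: Z_def invertible_def)
  have KZv: "K *v (Z *v x) = x" and ZKv: "Z *v (K *v x) = x" for x
    by (simp_all add: KZ ZK matrix_vector_mul_assoc)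
  define S where "S = {x. Q *v x = 0}"
  have S: "subspace S" unfolding S_def by (rule linear_subspace_kernel) simp
  have CA: "C *v x = 0 \<and> transpose Q *v (A *v x) = 0" if x: "x \<in> S" for x
  proof -
    have lin: "u \<bullet> (C *v x) = (Q *v \<xi>) \<bullet> (A *v x)" for u \<xi>
    proof -
      define a where "a = u \<bullet> (C *v x) - (Q *v \<xi>) \<bullet> (A *v x)"
      define c where "c = u \<bullet> (C *v \<xi> + D *v u) - (Q *v \<xi>) \<bullet> (A *v \<xi> + B *v u)"
      have *: "0 \<le> t * a + c" for t
        using diss[of "t *\<^sub>R x + \<xi>" u] x
        by (simp add: S_def a_def c_def matrix_vector_right_distrib matrix_vector_mult_scaleR
            inner_add_right algebra_simps)
      have "a = 0"
      proof (rule ccontr)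
        assume "a \<noteq> 0"
        then show False using *[of "- (c + 1) / a"] by simp
      qed
      then show ?thesis by (simp add: a_def)
    qed
    have "C *v x = 0" using lin[of "C *v x" 0] by simp
    moreover have "transpose Q *v (A *v x) = 0"
      using lin[of 0 "transpose Q *v (A *v x)"] inner_transpose_mult[of "transpose Q *v (A *v x)"
          Q "A *v x"]
      by (simp del: transpose_matrix_vector)
    ultimately show ?thesis ..
  qed
  have QE: "transpose Q *v (E *v x) = 0" if x: "x \<in> S" for x
  proof -
    have "transpose Q *v (E *v x) = transpose E *v (Q *v x)"
      by (simp add: matrix_vector_mul_assoc sym del: transpose_matrix_vector)
    then show ?thesis using x by (simp add: S_def)
  qed
  define T where "T = {x. transpose Q *v x = 0}"
  have ET: "E *v x \<in> T" and ZT: "Z *v x \<in> T" if "x \<in> S" for x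
    using QE[OF that] CA[OF that]
    by (simp_all add: T_def Z_def matrix_vector_mult_diff_rdistrib matrix_vector_mult_diff_distrib
        matrix_vector_mult_scaleR flip: scaleR_matrix_vector_assoc del: transpose_matrix_vector)
  have "(*v) Z ` S = T"
  proof (rule subspace_dim_equal)
    show "subspace ((*v) Z ` S)" using S by (intro linear_subspace_image) auto
    show "subspace T"
      unfolding T_def by (rule linear_subspace_kernel) (simp del: transpose_matrix_vector)
    show "(*v) Z ` S \<subseteq> T" using ZT by auto
    have "dim ((*v) Z ` S) = dim S"
      by (rule dim_image_eq) (auto intro: inj_on_inverseI KZv)
    then show "dim T \<le> dim ((*v) Z ` S)" using dim_kernel_transpose[of Q] by (simp add: S_def T_def)
  qed
  then have KT: "K *v y \<in> S" if "y \<in> T" for y using that KZv by force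
  have "x = 0" if x: "x \<in> S" for x
  proof (rule ccontr)
    assume "x \<noteq> 0"
    have "(K ** E) *v y \<in> S" if "y \<in> S" for y
      using KT[OF ET[OF that]] by (simp add: matrix_vector_mul_assoc)
    then obtain v \<mu> where v: "v \<noteq> 0" "re_vec v \<in> S" "im_vec v \<in> S" "cmat (K ** E) *v v = \<mu> *s v"
      using real_invariant_subspace_eigenvector[OF S x \<open>x \<noteq> 0\<close>] by blast
    have Cv: "cmat C *v v = 0" using CA v by (intro cmat_mult_eq_0) blast+
    have "cmat E *v v = cmat Z *v (cmat K *v (cmat E *v v))"
    proof -
      have "cmat Z ** cmat K = mat 1" by (simp add: ZK cmat_mat_1 flip: cmat_mult)
      then show ?thesis by (simp add: matrix_vector_mul_assoc matrix_mul_assoc)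
    qed
    also have "\<dots> = \<mu> *s (cmat Z *v v)"
      using v(4) by (simp add: cmat_mult vector_scalar_commute flip: matrix_vector_mul_assoc)
    also have "cmat Z *v v = of_real s *s (cmat E *v v) - cmat A *v v"
      unfolding Z_def cmat_pencil[symmetric] by (simp add: pencil_mult_vec)
    finally have "(1 - \<mu> * of_real s) *s (cmat E *v v) = (- \<mu>) *s (cmat A *v v)"
      by (simp add: vec_eq_iff algebra_simps)
    \<comment> \<open>\<open>\<mu> = 0\<close> gives \<open>(1, 0)\<close>, the eigenvalue at
      infinity.\<close>
    moreover have "(1 - \<mu> * of_real s, - \<mu>) \<noteq> (0, 0)" by auto
    ultimately have "v = 0" using completely_observableD[OF obs _ _ Cv] by blast
    then show False using v(1) by blast
  qed
  then have "\<exists>B. B ** Q = mat 1" unfolding S_def matrix_left_invertible_ker by blast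
  then show ?thesis by (simp add: invertible_left_inverse)
qed

section \<open>Block matrices and the port-Hamiltonian coefficients\<close>

lemma block_mult_vec:
  fixes x :: "real ^ ('n::finite + 'm::finite)"
  shows "(block M11 M12 M21 M22 *v x) $ Inl i = (M11 *v (\<chi> i. x $ Inl i)) $ i + (M12 *v (\<chi> i. x $
      Inr i)) $ i"
    and "(block M11 M12 M21 M22 *v x) $ Inr j = (M21 *v (\<chi> i. x $ Inl i)) $ j + (M22 *v (\<chi> i. x $
        Inr i)) $ j"
  by (simp_all add: block_def vblock_def hblock_def matrix_vector_mult_def
      UNIV_Plus_UNIV[symmetric] sum.Plus del: UNIV_Plus_UNIV)

lemma transpose_block:
  "transpose (block M11 M12 M21 M22) = block (transpose M11) (transpose M21) (transpose M12)
      (transpose M22)"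
  by (auto simp: transpose_def block_def vblock_def hblock_def vec_eq_iff split: sum.splits)

lemma inner_block_mult:
  fixes x :: "real ^ ('n::finite + 'm::finite)"
  defines "y \<equiv> \<chi> i. x $ Inl i" and "z \<equiv> \<chi> i. x $ Inr i"
  shows "x \<bullet> (block M11 M12 M21 M22 *v x)
    = y \<bullet> (M11 *v y) + y \<bullet> (M12 *v z) + z \<bullet> (M21 *v y) + z \<bullet> (M22 *v z)"
proof -
  have "x \<bullet> w = (\<Sum>i\<in>UNIV. y $ i * w $ Inl i) + (\<Sum>i\<in>UNIV. z $ i * w $ Inr i)" for w
    by (simp add: inner_vec_def y_def z_def UNIV_Plus_UNIV[symmetric] sum.Plus del: UNIV_Plus_UNIV)
  note split = this
  have "(block M11 M12 M21 M22 *v x) $ Inl i = (M11 *v y + M12 *v z) $ i"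
    "(block M11 M12 M21 M22 *v x) $ Inr j = (M21 *v y + M22 *v z) $ j" for i j
    by (simp_all add: block_mult_vec y_def z_def)
  then have "x \<bullet> (block M11 M12 M21 M22 *v x) = y \<bullet> (M11 *v y + M12 *v z) + z \<bullet> (M21 *v y + M22 *v
      z)"
    unfolding split by (simp only: inner_vec_def inner_real_def)
  then show ?thesis by (simp add: inner_add_right)
qed

text \<open>\<open>J\<close> and \<open>-R\<close> are the skew and symmetric parts of
  \<open>A Q^-1\<close>; \<open>G\<close> and \<open>P\<close> are half the sum and half the
  difference of \<open>Q^-T C^T\<close> and \<open>B\<close>. The form of the dissipation block at
  \<open>(y, z)\<close> is then the slack
  \<open>z \<bullet> (C y + D z) - Q y \<bullet> (A y + B z)\<close>.\<close>

lemma port_hamiltonian_of_dissipation: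
  fixes E A Q :: "real ^ 'n ^ 'n" and B :: "real ^ 'm ^ 'n" and C :: "real ^ 'n ^ 'm"
  assumes Q: "invertible Q" and EQ: "psd (transpose E ** Q)"
    and diss: "\<And>\<xi> u. (Q *v \<xi>) \<bullet> (A *v \<xi> + B *v u) \<le> u \<bullet> (C *v \<xi> + D *v u)"
  shows "port_hamiltonian E A B C D"
proof -
  obtain Qi where QiQ: "Qi ** Q = mat 1" using Q by (auto simp: invertible_def)
  define F where "F = A ** Qi"
  define H where "H = transpose (C ** Qi)"
  have FQ: "F ** Q = A" and HQ: "transpose H ** Q = C"
    by (simp_all add: F_def H_def QiQ flip: matrix_mul_assoc)
  define J where "J = (1/2) *\<^sub>R (F - transpose F)"
  define R where "R = - (1/2) *\<^sub>R (F + transpose F)"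
  define G where "G = (1/2) *\<^sub>R (H + B)"
  define P where "P = (1/2) *\<^sub>R (H - B)"
  define S where "S = (1/2) *\<^sub>R (D + transpose D)"
  define N where "N = (1/2) *\<^sub>R (D - transpose D)"
  have JR: "J - R = F" and GP: "G - P = B" "G + P = H" and SN: "S + N = D"
    by (simp_all add: J_def R_def G_def P_def S_def N_def vec_eq_iff algebra_simps)
  have R_sym: "transpose R = R" and S_sym: "transpose S = S"
    by (simp_all add: R_def S_def transpose_def vec_eq_iff algebra_simps)
  have skew: "block J G (- transpose G) N = - transpose (block J G (- transpose G) N)"
    unfolding transpose_block
    by (auto simp: J_def N_def transpose_def block_def vblock_def hblock_def vec_eq_iff
        algebra_simps
        split: sum.splits)
  define X where "X = block (transpose Q ** R ** Q) (transpose Q ** P) (transpose P ** Q) S"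
  have "psd X"
    unfolding psd_def
  proof (intro conjI allI)
    show "transpose X = X"
      by (simp add: X_def transpose_block matrix_transpose_mul R_sym S_sym matrix_mul_assoc)
    fix x :: "real ^ ('n + 'm)"
    define y where "y = (\<chi> i. x $ Inl i)"
    define z where "z = (\<chi> i. x $ Inr i)"
    have neg: "(- M) *v w = - (M *v w)" for M :: "real ^ 'n ^ 'n" and w
      by (simp add: matrix_vector_mult_def vec_eq_iff sum_negf)
    have FR: "w \<bullet> (R *v w) = - (w \<bullet> (F *v w))" for w
      by (simp add: R_def neg matrix_vector_mult_add_rdistrib inner_add_right inner_transpose_mult
          inner_commute[of "F *v w"] del: transpose_matrix_vector flip: scaleR_matrix_vector_assoc)
    have "y \<bullet> ((transpose Q ** R ** Q) *v y) = - ((Q *v y) \<bullet> (F *v (Q *v y)))"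
      by (simp add: inner_transpose_mult FR del: transpose_matrix_vector flip:
          matrix_vector_mul_assoc)
    also have "\<dots> = - ((Q *v y) \<bullet> (A *v y))" by (simp add: matrix_vector_mul_assoc FQ)
    finally have 1: "y \<bullet> ((transpose Q ** R ** Q) *v y) = - ((Q *v y) \<bullet> (A *v y))" .
    have P2: "(Q *v y) \<bullet> (P *v z) = (1/2) * (z \<bullet> (C *v y) - (Q *v y) \<bullet> (B *v z))"
    proof -
      have "(Q *v y) \<bullet> (H *v z) = z \<bullet> (C *v y)"
        by (metis HQ inner_commute inner_transpose_mult matrix_vector_mul_assoc)
      then show ?thesis
        by (simp add: P_def matrix_vector_mult_diff_rdistrib inner_diff_right
            flip: scaleR_matrix_vector_assoc)
    qed
    have 2: "y \<bullet> ((transpose Q ** P) *v z) = (Q *v y) \<bullet> (P *v z)"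
      by (simp add: inner_transpose_mult del: transpose_matrix_vector flip: matrix_vector_mul_assoc)
    have 3: "z \<bullet> ((transpose P ** Q) *v y) = (Q *v y) \<bullet> (P *v z)"
      by (simp add: inner_transpose_mult inner_commute del: transpose_matrix_vector
          flip: matrix_vector_mul_assoc)
    have 4: "z \<bullet> (S *v z) = z \<bullet> (D *v z)"
      by (simp add: S_def matrix_vector_mult_add_rdistrib inner_add_right inner_transpose_mult
          inner_commute[of "D *v z"] del: transpose_matrix_vector flip: scaleR_matrix_vector_assoc)
    show "0 \<le> x \<bullet> (X *v x)"
      unfolding X_def inner_block_mult y_def[symmetric] z_def[symmetric] 1 2 3 4 P2
      using diss[of y z] by (simp add: inner_add_right)
  qed
  moreover have "transpose Q ** E = transpose E ** Q"
    using EQ by (simp add: psd_def matrix_transpose_mul)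
  ultimately show ?thesis
    unfolding port_hamiltonian_def Let_def
    using EQ skew JR GP SN FQ HQ
    by (intro exI[of _ J] exI[of _ R] exI[of _ Q] exI[of _ G] exI[of _ P])
      (simp flip: S_def N_def X_def)
qed

section \<open>The discrete-time system of a positive real descriptor system\<close>

definition markov :: "real ^ 'n ^ 'n \<Rightarrow> real ^ 'm ^ 'n \<Rightarrow> nat \<Rightarrow> real ^ 'm ^ 'n" where
  "markov A B l = (((**) A) ^^ l) B"

lemma markov_simps [simp]: "markov A B 0 = B" "markov A B (Suc l) = A ** markov A B l"
  by (simp_all add: markov_def)

definition markov_fps :: "real ^ 'n ^ 'n \<Rightarrow> real ^ 'm ^ 'n \<Rightarrow> 'n \<Rightarrow> 'm \<Rightarrow> complex fps" where
  "markov_fps A B k j = Abs_fps (\<lambda>l. of_real (markov A B l $ k $ j))"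

text \<open>Submultiplicativity of a crude entry-sum norm; any geometric bound gives a positive
  radius of convergence.\<close>

lemma markov_bound:
  fixes A :: "real ^ 'n ^ 'n"
  shows "\<bar>markov A B l $ k $ j\<bar> \<le> (\<Sum>k\<in>UNIV. \<Sum>m\<in>UNIV. \<bar>A $ k $ m\<bar>) ^ l * (\<Sum>k\<in>UNIV. \<bar>B $ k $ j\<bar>)"
    (is "_ \<le> ?a ^ l * ?b")
proof (induction l arbitrary: k)
  case 0
  show ?case by (simp add: member_le_sum[of k UNIV "\<lambda>k. \<bar>B $ k $ j\<bar>"])
next
  case (Suc l)
  have nonneg: "0 \<le> ?a ^ l * ?b" by (intro mult_nonneg_nonneg zero_le_power sum_nonneg) auto
  have "\<bar>markov A B (Suc l) $ k $ j\<bar> \<le> (\<Sum>m\<in>UNIV. \<bar>A $ k $ m\<bar> * \<bar>markov A B l $ m $ j\<bar>)"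
    by (simp add: matrix_matrix_mult_def order_trans[OF sum_abs] flip: abs_mult)
  also have "\<dots> \<le> (\<Sum>m\<in>UNIV. \<bar>A $ k $ m\<bar> * (?a ^ l * ?b))"
    by (intro sum_mono mult_left_mono Suc.IH) auto
  also have "\<dots> = (\<Sum>m\<in>UNIV. \<bar>A $ k $ m\<bar>) * (?a ^ l * ?b)" by (simp add: sum_distrib_right)
  also have "\<dots> \<le> ?a * (?a ^ l * ?b)"
    by (intro mult_right_mono nonneg member_le_sum[of k UNIV "\<lambda>k. \<Sum>m\<in>UNIV. \<bar>A $ k $ m\<bar>"])
      (auto intro: sum_nonneg)
  finally show ?case by (simp add: mult.assoc)
qed

lemma markov_fps_radius: "fps_conv_radius (markov_fps A B k j) > 0"
proof -
  define a where "a = (\<Sum>k\<in>UNIV. \<Sum>m\<in>UNIV. \<bar>A $ k $ m\<bar>)"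
  define b where "b = (\<Sum>k\<in>UNIV. \<bar>B $ k $ j\<bar>)"
  \<comment> \<open>The \<open>+ 1\<close> covers \<open>A = 0\<close>, where
    \<open>a = 0\<close>.\<close>
  define r where "r = 1 / (2 * (a + 1))"
  have a: "a \<ge> 0" unfolding a_def by (intro sum_nonneg) auto
  have b: "b \<ge> 0" unfolding b_def by (intro sum_nonneg) auto
  have r: "r > 0" "a * r \<le> 1 / 2" using a by (auto simp: r_def field_simps)
  have "summable (\<lambda>l. complex_of_real (markov A B l $ k $ j) * of_real r ^ l)"
  proof (rule summable_comparison_test)
    show "\<exists>N. \<forall>l\<ge>N. norm (complex_of_real (markov A B l $ k $ j) * of_real r ^ l) \<le> b * (1 / 2) ^ l"
    proof (intro exI[of _ 0] allI impI)
      fix l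
      have "norm (complex_of_real (markov A B l $ k $ j) * of_real r ^ l) = \<bar>markov A B l $ k $ j\<bar>
          * r ^ l"
        using r by (simp add: norm_mult norm_power)
      also have "\<dots> \<le> (a ^ l * b) * r ^ l"
        using markov_bound[of A B l k j] r by (intro mult_right_mono) (auto simp: a_def b_def)
      also have "\<dots> = b * (a * r) ^ l" by (simp add: power_mult_distrib)
      also have "\<dots> \<le> b * (1 / 2) ^ l"
        using a b r by (intro mult_left_mono power_mono) auto
      finally show "norm (complex_of_real (markov A B l $ k $ j) * of_real r ^ l) \<le> b * (1 / 2) ^
          l" .
    qed
    show "summable (\<lambda>l. b * (1 / 2) ^ l)" by (intro summable_mult summable_geometric) simp
  qed
  then have "norm (complex_of_real r) \<le> conv_radius (\<lambda>l. complex_of_real (markov A B l $ k $ j))"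
    by (rule conv_radius_geI)
  moreover have "0 < ereal (norm (complex_of_real r))" using r by simp
  ultimately show ?thesis unfolding fps_conv_radius_def markov_fps_def fps_nth_Abs_fps
    by (rule less_le_trans[rotated])
qed

lemma markov_fps_expansion: "eval_fps (markov_fps A B k j) has_fps_expansion markov_fps A B k j"
  by (rule eval_fps_has_fps_expansion markov_fps_radius)+

definition resolvent_column :: "real ^ 'n ^ 'n \<Rightarrow> real ^ 'm ^ 'n \<Rightarrow> 'm \<Rightarrow> complex \<Rightarrow> complex ^ 'n" where
  "resolvent_column A B j z = (\<chi> k. eval_fps (markov_fps A B k j) z)"

text \<open>Serves twice: with \<open>c\<close> a row of \<open>A\<close> it reproduces the
  resolvent series, with \<open>c\<close> a row of the output matrix it gives the transfer
  function.\<close>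

lemma affine_markov_expansion:
  "(\<lambda>z. of_real d + z * (\<Sum>m\<in>UNIV. of_real (c m) * eval_fps (markov_fps A B m j) z))
    has_fps_expansion Abs_fps (\<lambda>l. of_real (case l of 0 \<Rightarrow> d | Suc l \<Rightarrow> \<Sum>m\<in>UNIV. c m * markov A B l
        $ m $ j))"
proof -
  have "(\<lambda>z. of_real d + z * (\<Sum>m\<in>UNIV. of_real (c m) * eval_fps (markov_fps A B m j) z))
    has_fps_expansion (fps_const (of_real d) + fps_X * (\<Sum>m\<in>UNIV. fps_const (of_real (c m)) *
        markov_fps A B m j))"
    by (intro fps_expansion_intros markov_fps_expansion)
  also have "fps_const (of_real d) + fps_X * (\<Sum>m\<in>UNIV. fps_const (of_real (c m)) * markov_fps A B
      m j)
     = Abs_fps (\<lambda>l. of_real (case l of 0 \<Rightarrow> d | Suc l \<Rightarrow> \<Sum>m\<in>UNIV. c m * markov A B l $ m $ j))"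
    by (rule fps_ext) (simp add: markov_fps_def fps_sum_nth split: nat.split)
  finally show ?thesis .
qed

lemma resolvent_column_eq:
  "\<forall>\<^sub>F z in nhds 0. \<forall>j. resolvent_column A B j z = cvec (column j B) + z *s (cmat A *v
      resolvent_column A B j z)"
proof -
  have "\<forall>\<^sub>F z in nhds 0. eval_fps (markov_fps A B k j) z =
      of_real (B $ k $ j) + z * (\<Sum>m\<in>UNIV. of_real (A $ k $ m) * eval_fps (markov_fps A B m j) z)"
          for j k
  proof -
    have "Abs_fps (\<lambda>l. of_real (case l of 0 \<Rightarrow> B $ k $ j | Suc l \<Rightarrow> \<Sum>m\<in>UNIV. A $ k $ m * markov A B
        l $ m $ j))
      = markov_fps A B k j"
      by (rule fps_ext) (simp add: markov_fps_def matrix_matrix_mult_def split: nat.split)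
    then show ?thesis
      using affine_markov_expansion[of "B $ k $ j" "\<lambda>m. A $ k $ m" A B j]
      by (simp add: has_fps_expansion_def)
  qed
  then have "\<forall>\<^sub>F z in nhds 0. \<forall>j k. eval_fps (markov_fps A B k j) z =
      of_real (B $ k $ j) + z * (\<Sum>m\<in>UNIV. of_real (A $ k $ m) * eval_fps (markov_fps A B m j) z)"
    by (intro eventually_all_finite)
  then show ?thesis
  proof eventually_elim
    case (elim z)
    have "resolvent_column A B j z $ k
        = (cvec (column j B) + z *s (cmat A *v resolvent_column A B j z)) $ k" for j k
      using elim[rule_format, of k j]
      by (simp add: resolvent_column_def cvec_def column_def matrix_vector_mult_def)
    then show ?case by (simp add: vec_eq_iff)
  qed
qed

lemma matrix_vector_mult_sum_right: "M *v (\<Sum>i\<in>I. f i) = (\<Sum>i\<in>I. M *v f i)"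
  for M :: "real ^ 'n ^ 'm"
  by (simp add: linear_sum)

lemma traj_markov: "traj A B u k = (\<Sum>l<k. markov A B (k - Suc l) *v u l)"
proof (induction k)
  case (Suc k)
  have "A *v (\<Sum>l<k. markov A B (k - Suc l) *v u l) = (\<Sum>l<k. markov A B (k - l) *v u l)"
    unfolding matrix_vector_mult_sum_right
    by (intro sum.cong) (auto simp: matrix_vector_mul_assoc Suc_diff_Suc simp flip: markov_simps(2))
  then show ?case by (simp add: Suc.IH)
qed simp

lemma matrix_inv_inverse:
  assumes "invertible M"
  shows "matrix_inv M ** M = mat 1" "M ** matrix_inv M = mat 1"
  using someI_ex[of "\<lambda>M'. M ** M' = mat 1 \<and> M' ** M = mat 1"] assms
  by (auto simp: matrix_inv_def invertible_def)

lemma cmat_add: "cmat (M + N) = cmat M + cmat N"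
  by (simp add: vec_eq_iff)

lemma cmat_diff: "cmat (M - N) = cmat M - cmat N"
  by (simp add: vec_eq_iff)

text \<open>The real part is \<open>(1 - |z|^2) / |1 + z|^2\<close>.\<close>

lemma Re_cayley_pos:
  assumes "norm z < 1"
  shows "0 < Re ((1 - z) / (1 + z))" "1 + z \<noteq> 0"
proof -
  show nz: "1 + z \<noteq> 0"
    using assms by (metis add.inverse_unique norm_minus_cancel norm_one order_less_irrefl)
  have "Re ((1 - z) / (1 + z)) = (1 - (norm z)\<^sup>2) / (norm (1 + z))\<^sup>2"
    unfolding cmod_power2 by (simp add: Re_divide power2_eq_square algebra_simps)
  moreover have "(norm z)\<^sup>2 < 1" using assms by (simp add: abs_square_less_1)
  ultimately show "0 < Re ((1 - z) / (1 + z))" using nz by simp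
qed

lemma Re_complex_of_real_mult: "Re (of_real r * z) = r * Re z"
  by simp

text \<open>The Cayley transform \<open>s = \<sigma> (1 - z) / (1 + z)\<close> turns \<open>E \<eta> = A \<xi> + B u\<close> with
  \<open>\<xi> = x\<^sup>+ + x\<close> and \<open>\<eta> = \<sigma> (x\<^sup>+ - x)\<close> into an ordinary discrete-time system, in
  which the infinite eigenvalues of the pencil sit at \<open>z = -1\<close>, and the transfer function into a
  function on the unit disc whose Taylor coefficients are the impulse response.\<close>

lemma positive_real_storage:
  fixes E A :: "real ^ 'n ^ 'n" and B :: "real ^ 'm ^ 'n"
    and C :: "real ^ 'n ^ 'm" and D :: "real ^ 'm ^ 'm"
  assumes reg: "regular_pencil E A" and ctrl: "completely_controllable E A B"
    and pr: "positive_real E A B C D"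
  obtains P where "psd P"
    "\<And>\<xi> \<eta> u. E *v \<eta> = A *v \<xi> + B *v u \<Longrightarrow> \<xi> \<bullet> (P *v \<eta>) \<le> u \<bullet> (C *v \<xi> + D *v u)"
proof -
  obtain s :: real where s: "s > 0" and det: "det (pencil (of_real s) 1 E A) \<noteq> 0"
    using regular_pencil_positive_point[OF reg] .
  define Z where "Z = s *\<^sub>R E - A"
  obtain K where KZ: "K ** Z = mat 1" and ZK: "Z ** K = mat 1"
    using invertible_real_pencil[OF det] by (auto simp: Z_def invertible_def)
  \<comment> \<open>Solving \<open>s E (x' - x) = A (x' + x) + B u\<close> gives
    \<open>x' = Ad x + Bd u\<close> with \<open>Ad = Z^-1 (s E + A) = 2 s Z^-1 E - I\<close>;
    \<open>Cd\<close> and \<open>Dd\<close> rewrite the output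
    \<open>C (x' + x) + D u\<close>.\<close>
  define Ad where "Ad = (2 * s) *\<^sub>R (K ** E) - mat 1"
  define Bd where "Bd = K ** B"
  define Cd where "Cd = C ** (Ad + mat 1)"
  define Dd where "Dd = C ** Bd + D"
  have Zv: "cmat Z *v x = of_real s *s (cmat E *v x) - cmat A *v x" for x
    unfolding Z_def cmat_pencil[symmetric] by (simp add: pencil_mult_vec)
  have ZAd: "Z ** Ad = (2 * s) *\<^sub>R E - Z"
  proof -
    have "Z *v (K *v x) = x" for x by (simp add: matrix_vector_mul_assoc ZK)
    then show ?thesis
      by (simp add: matrix_eq Ad_def matrix_vector_mult_diff_rdistrib
          matrix_vector_mult_diff_distrib
          matrix_vector_mult_scaleR flip: matrix_vector_mul_assoc scaleR_matrix_vector_assoc)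
  qed
  have ZAdv: "cmat Z *v (cmat Ad *v x) = of_real s *s (cmat E *v x) + cmat A *v x" for x
  proof -
    have "cmat Z *v (cmat Ad *v x) = cmat ((2 * s) *\<^sub>R E - Z) *v x"
      by (simp add: matrix_vector_mul_assoc ZAd flip: cmat_mult)
    also have "\<dots> = of_real (2 * s) *s (cmat E *v x) - cmat Z *v x"
      unfolding cmat_pencil[symmetric] by (simp add: pencil_mult_vec)
    finally show ?thesis unfolding Zv by (simp add: vec_eq_iff algebra_simps)
  qed
  have ZBd: "Z ** Bd = B" by (simp add: Bd_def ZK matrix_mul_assoc)

  obtain T where T: "\<And>w. Re w > 0 \<Longrightarrow> det (pencil w 1 E A) \<noteq> 0 \<Longrightarrow> T w = transfer_function E A B C D w"
    and T_an: "\<And>i j. (\<lambda>w. T w $ i $ j) analytic_on {w. Re w > 0}"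
    and T_psd: "\<And>w. Re w > 0 \<Longrightarrow> hermitian_psd (T w + hermitian_transpose (T w))"
    using pr unfolding positive_real_def by blast
  define \<phi> where "\<phi> z = of_real s * ((1 - z) / (1 + z))" for z :: complex
  have \<phi>_pos: "Re (\<phi> z) > 0" if "norm z < 1" for z
    unfolding \<phi>_def Re_complex_of_real_mult using Re_cayley_pos[OF that] s by simp
  define F where "F z = T (\<phi> z)" for z
  define h where "h l = (case l of 0 \<Rightarrow> Dd | Suc l \<Rightarrow> Cd ** markov Ad Bd l)" for l
  have hol: "(\<lambda>z. F z $ i $ j) holomorphic_on ball 0 1" for i j
  proof -
    have "\<phi> holomorphic_on ball 0 1"
      unfolding \<phi>_def by (intro holomorphic_intros) (use Re_cayley_pos in auto)
    moreover have "(\<lambda>w. T w $ i $ j) holomorphic_on {w. Re w > 0}"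
      using T_an by (rule analytic_imp_holomorphic)
    moreover have "\<phi> ` ball 0 1 \<subseteq> {w. Re w > 0}" using \<phi>_pos by auto
    ultimately have "(\<lambda>w. T w $ i $ j) \<circ> \<phi> holomorphic_on ball 0 1"
      by (rule holomorphic_on_compose_gen)
    then show ?thesis by (simp add: F_def o_def)
  qed
  \<comment> \<open>A neighbourhood of 0 suffices, since Taylor coefficients are local and
    \<open>\<phi> 0 = s\<close>. At zeros of the determinant elsewhere in the disc,
    \<open>hol\<close> rests on the continuation \<open>T\<close>.\<close>
  have det_ev: "\<forall>\<^sub>F z in nhds 0. det (pencil (\<phi> z) 1 E A) \<noteq> 0"
  proof -
    obtain p where p: "\<And>t. det (pencil (0 + t * 1) (1 + t * 0) E A) = poly p t"
      using det_pencil_poly by blast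
    have "isCont (\<lambda>z. poly p (\<phi> z)) 0"
      unfolding \<phi>_def by (intro continuous_intros isCont_o2[OF _ poly_isCont]) auto
    then have "((\<lambda>z. poly p (\<phi> z)) \<longlongrightarrow> poly p (\<phi> 0)) (at 0)"
      by (simp only: isCont_def)
    moreover have nz: "poly p (\<phi> 0) \<noteq> 0" using det p[of "of_real s"] by (simp add: \<phi>_def)
    ultimately have "\<forall>\<^sub>F z in at 0. poly p (\<phi> z) \<noteq> 0"
      by (rule tendsto_imp_eventually_ne)
    then have "\<forall>\<^sub>F z in nhds 0. poly p (\<phi> z) \<noteq> 0"
      using nz by (simp add: eventually_nhds_conv_at)
    then show ?thesis using p by simp
  qed
  have norm_ev: "\<forall>\<^sub>F z in nhds (0 :: complex). norm z < 1"
    using eventually_nhds_in_open[of "ball 0 1" "0 :: complex"] by simp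
  have F_ev: "\<forall>\<^sub>F z in nhds 0. \<forall>j. column j (F z) = cvec (column j Dd) + z *s (cmat Cd *v
      resolvent_column Ad Bd j z)"
    using det_ev norm_ev resolvent_column_eq[of Ad Bd]
  proof (eventually_elim, intro allI)
    fix z j
    assume det: "det (pencil (\<phi> z) 1 E A) \<noteq> 0" and z: "norm z < 1"
      and "\<forall>j. resolvent_column Ad Bd j z = cvec (column j Bd) + z *s (cmat Ad *v resolvent_column
          Ad Bd j z)"
    define x where "x = resolvent_column Ad Bd j z"
    have x: "x = cvec (column j Bd) + z *s (cmat Ad *v x)"
      using \<open>\<forall>j. _\<close> by (simp add: x_def)
    \<comment> \<open>The aim is \<open>Pz ((1 + z) x) = B_j\<close>, with \<open>B_j\<close> column
      \<open>j\<close> of \<open>B\<close>; the factor \<open>1 + z\<close> clears the denominator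
      of \<open>\<phi> z\<close>.\<close>
    define Pz where "Pz = pencil (\<phi> z) 1 E A"
    have "\<phi> z * (1 + z) = of_real s * (1 - z)"
      using Re_cayley_pos(2)[OF z] by (simp add: \<phi>_def)
    then have "(1 + z) *s (Pz *v x) = (of_real s * (1 - z)) *s (cmat E *v x) - (1 + z) *s (cmat A
        *v x)"
      by (simp add: Pz_def pencil_mult_vec vector_ssub_ldistrib vector_smult_assoc mult.commute)
    also have "\<dots> = cmat Z *v x - z *s (cmat Z *v (cmat Ad *v x))"
      unfolding ZAdv unfolding Zv by (simp add: vec_eq_iff algebra_simps)
    also have "\<dots> = cmat Z *v (x - z *s (cmat Ad *v x))"
      by (simp add: matrix_vector_mult_diff_distrib vector_scalar_commute)
    also have "x - z *s (cmat Ad *v x) = cvec (column j Bd)"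
      using x by (simp add: algebra_simps)
    also have "cmat Z *v cvec (column j Bd) = cvec (column j B)"
      by (simp add: cmat_mult_cvec ZBd flip: matrix_vector_mult_basis matrix_vector_mul_assoc)
        (simp add: matrix_vector_mul_assoc ZBd)
    finally have Px: "Pz *v ((1 + z) *s x) = cvec (column j B)"
      by (simp only: vector_scalar_commute)
    have inv: "invertible Pz" using det by (simp add: Pz_def invertible_det_nz)
    have "matrix_inv Pz *v cvec (column j B) = (1 + z) *s x"
      unfolding Px[symmetric] by (simp add: matrix_vector_mul_assoc matrix_inv_inverse[OF inv])
    moreover have "F z = cmat C ** matrix_inv Pz ** cmat B + cmat D"
      unfolding F_def T[OF \<phi>_pos[OF z] det] transfer_function_def Pz_def ..
    moreover have "column j (M ** cmat N) = M *v cvec (column j N)" for M :: "complex ^ 'n ^ 'm"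
        and N :: "real ^ 'm ^ 'n"
      by (simp add: column_def matrix_matrix_mult_def matrix_vector_mult_def cvec_def vec_eq_iff)
    moreover have "column j (M + cmat D) = column j M + cvec (column j D)" for M
      by (simp add: column_def cvec_def vec_eq_iff)
    ultimately have Fz: "column j (F z) = (1 + z) *s (cmat C *v x) + cvec (column j D)"
      by (simp add: vector_scalar_commute matrix_vector_right_distrib flip: matrix_vector_mul_assoc)
    have Cx: "cmat C *v x = cmat C *v cvec (column j Bd) + z *s (cmat C *v (cmat Ad *v x))"
      by (subst x) (simp add: matrix_vector_right_distrib vector_scalar_commute)
    have Cdx: "cmat Cd *v x = cmat C *v (cmat Ad *v x) + cmat C *v x"
      by (simp add: Cd_def cmat_mult cmat_add cmat_mat_1 matrix_vector_mult_add_rdistrib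
          matrix_vector_right_distrib flip: matrix_vector_mul_assoc)
    have Ddj: "cvec (column j Dd) = cmat C *v cvec (column j Bd) + cvec (column j D)"
      by (simp add: Dd_def cmat_mult_cvec)
        (simp add: column_def cvec_def vec_eq_iff matrix_matrix_mult_def matrix_vector_mult_def)
    have "(1 + z) *s (cmat C *v x) = cmat C *v x + z *s (cmat C *v x)"
      by (simp add: vector_sadd_rdistrib)
    then show "column j (F z) = cvec (column j Dd) + z *s (cmat Cd *v x)"
      unfolding Fz Cdx Ddj using Cx by (simp add: vector_add_ldistrib)
  qed
  have h_fps: "(\<lambda>z. F z $ i $ j) has_fps_expansion Abs_fps (\<lambda>l. of_real (h l $ i $ j))" for i j
  proof -
    have "\<forall>\<^sub>F z in nhds 0. F z $ i $ j = of_real (Dd $ i $ j)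
        + z * (\<Sum>m\<in>UNIV. of_real (Cd $ i $ m) * eval_fps (markov_fps Ad Bd m j) z)"
      using F_ev by (rule eventually_mono)
        (simp add: vec_eq_iff column_def cvec_def matrix_vector_mult_def resolvent_column_def)
    moreover have "Abs_fps (\<lambda>l. complex_of_real (h l $ i $ j)) = Abs_fps (\<lambda>l. of_real (case l of 0
        \<Rightarrow> Dd $ i $ j
        | Suc l \<Rightarrow> \<Sum>m\<in>UNIV. Cd $ i $ m * markov Ad Bd l $ m $ j))"
      by (rule fps_ext) (simp add: h_def matrix_matrix_mult_def split: nat.split)
    ultimately show ?thesis
      using affine_markov_expansion[of "Dd $ i $ j" "\<lambda>m. Cd $ i $ m" Ad Bd j]
      by (subst has_fps_expansion_cong) auto
  qed
  have passivity: "0 \<le> total_supply Ad Bd Cd Dd u N" for u N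
  proof -
    have "Cd *v traj Ad Bd u k + Dd *v u k = (\<Sum>l\<le>k. h (k - l) *v u l)" for k
    proof -
      have "Cd *v traj Ad Bd u k = (\<Sum>l<k. h (k - l) *v u l)"
        unfolding traj_markov matrix_vector_mult_sum_right
      proof (rule sum.cong[OF refl])
        fix l assume "l \<in> {..<k}"
        then have "k - l = Suc (k - Suc l)" by auto
        then show "Cd *v (markov Ad Bd (k - Suc l) *v u l) = h (k - l) *v u l"
          by (simp add: h_def matrix_vector_mul_assoc)
      qed
      then show ?thesis by (simp add: h_def lessThan_Suc_atMost[symmetric])
    qed
    then have "total_supply Ad Bd Cd Dd u N = (\<Sum>k<N. \<Sum>l\<le>k. u k \<bullet> (h (k - l) *v u l))"
      by (simp add: total_supply_def inner_sum_right)
    also have "\<dots> \<ge> 0"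
      by (rule toeplitz_form_nonneg[of F]) (use hol h_fps T_psd \<phi>_pos in \<open>auto simp: F_def\<close>)
    finally show ?thesis .
  qed
  have reach: "\<exists>u N. traj Ad Bd u N = x" for x
  proof (rule reachable)
    fix w \<mu>
    assume w: "cmat (transpose Ad) *v w = \<mu> *s w" and Bw: "cmat (transpose Bd) *v w = 0"
    \<comment> \<open>With \<open>w = Z^T y\<close>, an eigenvector of \<open>Ad^T\<close> for
      \<open>\<mu>\<close> becomes a left null vector of the pencil at
      \<open>((1 - \<mu>) s, - (\<mu> + 1))\<close>. These entries never vanish together;
      \<open>\<mu> = -1\<close> is the eigenvalue at infinity.\<close>
    define y where "y = cmat (transpose K) *v w"
    have "transpose Z ** transpose K = mat 1"
      by (metis KZ matrix_transpose_mul transpose_mat)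
    then have wy: "w = cmat (transpose Z) *v y"
      by (simp add: y_def matrix_vector_mul_assoc cmat_mat_1 flip: cmat_mult)
    have Zy: "cmat (transpose Z) *v y = of_real s *s (cmat (transpose E) *v y) - cmat (transpose
        A) *v y"
    proof -
      have "transpose Z = s *\<^sub>R transpose E - transpose A"
        by (simp add: Z_def transpose_def vec_eq_iff)
      then show ?thesis by (simp add: pencil_mult_vec flip: cmat_pencil)
    qed
    have "transpose Ad = (2 * s) *\<^sub>R (transpose E ** transpose K) - mat 1"
      by (simp add: Ad_def transpose_def vec_eq_iff matrix_matrix_mult_def mat_def mult.commute)
    then have "cmat (transpose Ad) *v w = of_real (2 * s) *s (cmat (transpose E) *v y) - w"
      by (simp add: pencil_mult_vec cmat_mat_1 cmat_mult y_def matrix_vector_mul_assoc flip: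
          cmat_pencil)
    then have "of_real (2 * s) *s (cmat (transpose E) *v y) = (\<mu> + 1) *s w"
      using w by (simp add: vec_eq_iff algebra_simps)
    also have "\<dots> = (\<mu> + 1) *s (of_real s *s (cmat (transpose E) *v y) - cmat (transpose A) *v y)"
      using wy Zy by simp
    finally have "((1 - \<mu>) * of_real s) *s (cmat (transpose E) *v y) = (- (\<mu> + 1)) *s (cmat
        (transpose A) *v y)"
      by (simp add: vec_eq_iff algebra_simps)
    moreover have "((1 - \<mu>) * of_real s, - (\<mu> + 1)) \<noteq> (0, 0)"
      using s by auto
    moreover have "cmat (transpose B) *v y = 0"
      using Bw by (simp add: y_def Bd_def matrix_transpose_mul cmat_mult matrix_vector_mul_assoc)
    ultimately have "y = 0" using completely_controllableD[OF ctrl] by blast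
    then show "w = 0" using wy by simp
  qed
  obtain V where V: "psd V" and V_diss: "\<And>x u. (Ad *v x + Bd *v u) \<bullet> (V *v (Ad *v x + Bd *v u)) -
      x \<bullet> (V *v x)
      \<le> u \<bullet> (Cd *v x + Dd *v u)"
    using quadratic_storage_exists[OF passivity reach] by blast
  show thesis
  \<comment> \<open>\<open>x' \<bullet> V x' - x \<bullet> V x = (x' + x) \<bullet> V (x' -
    x)\<close> turns the discrete storage increment into \<open>\<xi> \<bullet> V \<delta>\<close>;
    the scaling \<open>1 / s\<close> comes from \<open>\<delta> = \<eta> / s\<close>.\<close>
  proof (rule that[of "(1 / s) *\<^sub>R V"])
    show "psd ((1 / s) *\<^sub>R V)"
      using V s by (simp add: psd_def transpose_scalar flip: scaleR_matrix_vector_assoc)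
    fix \<xi> \<eta> u assume eq: "E *v \<eta> = A *v \<xi> + B *v u"
    define \<delta> where "\<delta> = (1 / s) *\<^sub>R \<eta>"
    define x where "x = (1 / 2) *\<^sub>R (\<xi> - \<delta>)"
    define x' where "x' = (1 / 2) *\<^sub>R (\<xi> + \<delta>)"
    have \<xi>: "\<xi> = x' + x" and \<delta>: "\<delta> = x' - x" by (simp_all add: x_def x'_def vec_eq_iff field_simps)
    have "\<eta> = s *\<^sub>R (x' - x)" using s by (simp flip: \<delta> add: \<delta>_def)
    then have 1: "s *\<^sub>R (E *v x' - E *v x) = A *v \<xi> + B *v u"
      using eq by (simp add: matrix_vector_mult_diff_distrib matrix_vector_mult_scaleR)
    have 2: "Z *v \<xi> = s *\<^sub>R (E *v x' + E *v x) - A *v \<xi>"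
      by (simp add: Z_def \<xi> matrix_vector_mult_diff_rdistrib matrix_vector_right_distrib
          scaleR_add_right flip: scaleR_matrix_vector_assoc)
    have "Z *v \<xi> = (2 * s) *\<^sub>R (E *v x) + B *v u"
      using 1 unfolding 2 by (simp add: vec_eq_iff algebra_simps)
    then have "K *v (Z *v \<xi>) = (2 * s) *\<^sub>R ((K ** E) *v x) + Bd *v u"
      by (simp add: Bd_def matrix_vector_right_distrib matrix_vector_mult_scaleR flip:
          matrix_vector_mul_assoc)
    then have \<xi>': "\<xi> = (2 * s) *\<^sub>R ((K ** E) *v x) + Bd *v u"
      by (simp add: matrix_vector_mul_assoc KZ)
    then have x': "x' = Ad *v x + Bd *v u"
      using \<xi> by (simp add: Ad_def matrix_vector_mult_diff_rdistrib algebra_simps flip: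
          scaleR_matrix_vector_assoc)
    have "C *v \<xi> + D *v u = Cd *v x + Dd *v u"
      by (simp add: \<xi> x' Cd_def Dd_def matrix_vector_right_distrib matrix_vector_mult_add_rdistrib
          algebra_simps flip: matrix_vector_mul_assoc)
    moreover have "\<xi> \<bullet> (V *v \<delta>) = x' \<bullet> (V *v x') - x \<bullet> (V *v x)"
    proof -
      have "x \<bullet> (V *v x') = x' \<bullet> (V *v x)"
        by (metis V inner_commute inner_transpose_mult psd_def)
      then show ?thesis
        by (simp add: \<xi> \<delta> matrix_vector_mult_diff_distrib inner_add_left inner_diff_right)
    qed
    ultimately have "\<xi> \<bullet> (V *v \<delta>) \<le> u \<bullet> (C *v \<xi> + D *v u)"
      using V_diss[of x u] x' by simp
    then show "\<xi> \<bullet> (((1 / s) *\<^sub>R V) *v \<eta>) \<le> u \<bullet> (C *v \<xi> + D *v u)"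
      by (simp add: \<delta>_def matrix_vector_mult_scaleR flip: scaleR_matrix_vector_assoc)
  qed
qed

section \<open>The port-Hamiltonian realization\<close>

lemma transpose_zero: "transpose 0 = 0"
  by (simp add: transpose_def vec_eq_iff)

lemma matrix_mult_minus_left: "(- M) ** N = - (M ** N)"
  for M :: "'a::ring_1 ^ 'n ^ 'm"
  by (simp add: matrix_matrix_mult_def vec_eq_iff sum_negf)

lemma matrix_diff_mult: "(M - N) ** X = M ** X - N ** X"
  for M :: "'a::ring_1 ^ 'n ^ 'm"
  by (simp add: matrix_matrix_mult_def vec_eq_iff left_diff_distrib sum_subtractf)

lemma matrix_add_mult: "(M + N) ** X = M ** X + N ** X"
  for M :: "'a::ring_1 ^ 'n ^ 'm"
  by (simp add: matrix_matrix_mult_def vec_eq_iff distrib_right sum.distrib)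

text \<open>\<open>W^T E = 0\<close> gives \<open>W^T A = - W^T (s E - A)\<close>, so shifting
  \<open>C\<close> adds \<open>W^T B\<close> to the transfer function, which the shift of
  \<open>D\<close> removes.\<close>

lemma transfer_function_shift:
  assumes W: "transpose E ** W = 0" and det: "det (pencil s 1 E A) \<noteq> 0"
  shows "transfer_function E A B (C - transpose W ** A) (D - transpose W ** B) s
    = transfer_function E A B C D s"
proof -
  define M where "M = pencil s 1 E A"
  have inv: "invertible M" using det by (simp add: M_def invertible_det_nz)
  have "transpose W ** E = 0"
    using W by (metis matrix_transpose_mul transpose_transpose transpose_zero)
  then have WE: "cmat (transpose W) ** cmat E = 0"
    by (simp add: vec_eq_iff flip: cmat_mult)
  have WA: "cmat (transpose W) ** cmat A = - (cmat (transpose W) ** M)"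
  proof -
    have "(cmat (transpose W) ** cmat A) $ i $ j + (cmat (transpose W) ** M) $ i $ j
       = s * (cmat (transpose W) ** cmat E) $ i $ j" for i j
      by (simp add: M_def pencil_def matrix_matrix_mult_def sum_distrib_left algebra_simps flip:
          sum.distrib)
    then show ?thesis by (simp add: WE vec_eq_iff eq_neg_iff_add_eq_0)
  qed
  have "cmat (transpose W) ** cmat A ** matrix_inv M = - cmat (transpose W)"
    unfolding WA by (simp add: matrix_mult_minus_left matrix_inv_inverse[OF inv] flip:
        matrix_mul_assoc)
  then show ?thesis
    unfolding transfer_function_def M_def[symmetric]
    by (simp add: cmat_diff cmat_mult matrix_diff_mult matrix_add_mult)
qed

theorem theorem16:
  fixes E A :: "real ^ 'n ^ 'n"
    and B W :: "real ^ 'm ^ 'n"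
    and C :: "real ^ 'n ^ 'm"
    and D :: "real ^ 'm ^ 'm"
  assumes "regular_pencil E A"
    and "completely_controllable E A B"
    and "completely_observable E A C"
    and "positive_real E A B C D"
    and "transpose E ** W = 0"
    and "psd (D + transpose D - transpose B ** W - transpose W ** B)"
    and "completely_observable E A (C - transpose W ** A)"
  shows "port_hamiltonian E A B (C - transpose W ** A) (D - transpose W ** B) \<and>
    (\<forall>s. det (pencil s 1 E A) \<noteq> 0 \<longrightarrow>
       transfer_function E A B C D s =
       transfer_function E A B (C - transpose W ** A) (D - transpose W ** B) s)"
proof
  define C' where "C' = C - transpose W ** A"
  define D' where "D' = D - transpose W ** B"
  obtain P where P: "psd P"
    and diss: "\<And>\<xi> \<eta> u. E *v \<eta> = A *v \<xi> + B *v u \<Longrightarrow> \<xi> \<bullet> (P *v \<eta>) \<le> u \<bullet> (C *v \<xi> + D *v u)"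
    using positive_real_storage[OF assms(1,2,4)] by blast
  have WE: "transpose W ** E = 0"
    using assms(5) by (metis matrix_transpose_mul transpose_transpose transpose_zero)
  have diss': "\<xi> \<bullet> (P *v \<eta>) \<le> u \<bullet> (C' *v \<xi> + D' *v u)" if "E *v \<eta> = A *v \<xi> + B *v u" for \<xi> \<eta> u
  proof -
    have "C' *v \<xi> + D' *v u = C *v \<xi> + D *v u - transpose W *v (A *v \<xi> + B *v u)"
      by (simp add: C'_def D'_def matrix_vector_mult_diff_rdistrib matrix_vector_right_distrib
          matrix_vector_mul_assoc algebra_simps del: transpose_matrix_vector)
    also have "transpose W *v (A *v \<xi> + B *v u) = 0"
      unfolding that[symmetric] by (simp add: matrix_vector_mul_assoc WE del:
          transpose_matrix_vector)
    finally show ?thesis using diss[OF that] by simp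
  qed
  have D': "0 \<le> u \<bullet> (D' *v u)" for u
  proof -
    have "D + transpose D - transpose B ** W - transpose W ** B = D' + transpose D'"
    proof -
      have "transpose (D - transpose W ** B) = transpose D - transpose (transpose W ** B)"
        by (simp add: transpose_def vec_eq_iff)
      then show ?thesis by (simp add: D'_def matrix_transpose_mul)
    qed
    then have "0 \<le> u \<bullet> ((D' + transpose D') *v u)" using assms(6) by (simp add: psd_def)
    then show ?thesis
      by (simp add: matrix_vector_mult_add_rdistrib inner_add_right inner_transpose_mult
          inner_commute[of "D' *v u"] del: transpose_matrix_vector)
  qed
  \<comment> \<open>Controllability at infinity, \<open>(\<alpha>, \<beta>) = (1, 0)\<close>:
    \<open>[E, B]\<close> has full row rank.\<close>
  have ctrl: "w = 0" if "transpose E *v w = 0" "transpose B *v w = 0" for w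
  proof -
    have "cvec w = 0"
      by (rule completely_controllableD[OF assms(2), of 1 0])
        (simp_all add: cmat_mult_cvec that cvec_0 del: transpose_matrix_vector)
    then show ?thesis by (simp add: cvec_def vec_eq_iff)
  qed
  obtain Q where EQ: "transpose E ** Q = P"
    and Q: "\<And>\<xi> u. (Q *v \<xi>) \<bullet> (A *v \<xi> + B *v u) \<le> u \<bullet> (C' *v \<xi> + D' *v u)"
    using dissipation_extension[OF _ ctrl diss' D'] P unfolding psd_def by blast
  have "transpose Q ** E = transpose E ** Q"
    using EQ P by (metis matrix_transpose_mul psd_def transpose_transpose)
  then have "invertible Q"
    using invertible_storage_matrix[OF assms(1) assms(7)[folded C'_def] _ Q] by blast
  then show "port_hamiltonian E A B (C - transpose W ** A) (D - transpose W ** B)"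
    unfolding C'_def[symmetric] D'_def[symmetric]
    using EQ P Q by (intro port_hamiltonian_of_dissipation) auto
  show "\<forall>s. det (pencil s 1 E A) \<noteq> 0 \<longrightarrow> transfer_function E A B C D s =
       transfer_function E A B (C - transpose W ** A) (D - transpose W ** B) s"
    using transfer_function_shift[OF assms(5)] by metis
qed

end
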